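(* Let $B$ be an infinite Blaschke product with zeros $\{a_n\}$. If $-1 < \alpha \le 0$ and $\frac{2}{3} + \frac{2}{3}\alpha \le p < 1 + \alpha$, and if \[ \sum_n (1 - |a_n|)^{\frac{p}{2 - p}} < \infty, \] then $f' \in A^p_{\alpha}$ for all $f \in (BH^2)^{\perp}$.
   Context: $U$ denotes the open unit disc in $\mathbb{C}$. For $0<p<\infty$ and $\alpha>-1$, $A_\alpha^p$ is the set of all functions $f$ analytic in $U$ with $\|f\|_{A_\alpha^p} = \left\{\frac{1}{\pi}\iint_U |f(z)|^p (1-|z|)^\alpha\, dA(z)\right\}^{1/p} < \infty$, where $dA$ is Lebesgue area measure. If $\{a_n\}_{n\ge 1}$ is a sequence of complex numbers with $0<|a_n|<1$ for all $n$ and $\sum_n (1-|a_n|)<\infty$, the Blaschke product with zeros $\{a_n\}$ is the analytic function on $U$ given by $B(z) = \prod_{n=1}^\infty \frac{\bar a_n}{|a_n|}\frac{a_n - z}{1-\bar a_n z}$. $H^2$ is the Hardy space of analytic functions $f$ on $U$ with $\sup_{0<r<1}\left\{\frac{1}{2\pi}\int_0^{2\pi}|f(re^{it})|^2\,dt\right\}^{1/2}<\infty$, with its usual Hilbert space structure. $(BH^2)^\perp = H^2\ominus BH^2$ is the orthogonal complement in $H^2$ of the subspace $BH^2$ (the model space for $B$). *)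

theory Defs
  imports "HOL-Complex_Analysis.Complex_Analysis"
begin

text \<open>
  Analytic functions on the unit disc are total functions \<open>complex \<Rightarrow> complex\<close>
  that are holomorphic on \<open>ball 0 1\<close>; values outside the disc never matter below.
\<close>

abbreviation unit_disc :: "complex set" where
  "unit_disc \<equiv> ball 0 1"

text \<open>
  The factor \<open>1 / pi\<close> and the exponent \<open>1 / p\<close> of the norm are left out, since
  only finiteness is at stake. The intended range is \<open>0 < p\<close> and \<open>- 1 < \<alpha>\<close>.
\<close>

definition bergman_space :: "real \<Rightarrow> real \<Rightarrow> (complex \<Rightarrow> complex) set" where
  "bergman_space \<alpha> p =
     {f. f holomorphic_on unit_disc \<and>
         (\<integral>\<^sup>+ z\<in>unit_disc. ennreal (cmod (f z) powr p * (1 - cmod z) powr \<alpha>) \<partial>lborel) < \<infinity>}"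

definition hardy_space2 :: "(complex \<Rightarrow> complex) set" where
  "hardy_space2 =
     {f. f holomorphic_on unit_disc \<and>
         bdd_above ((\<lambda>r. sqrt (integral {0..2*pi} (\<lambda>t. (cmod (f (rcis r t)))\<^sup>2) / (2*pi)))
                      ` {0<..<1})}"

text \<open>
  The inner product inducing the norm of \<open>hardy_space2\<close>: for members of that space the
  radial limit exists and equals both the integral of the boundary values and the
  sum \<open>\<Sum>n. a n * cnj (b n)\<close> over the Taylor coefficients at 0.
\<close>

definition hardy_inner :: "(complex \<Rightarrow> complex) \<Rightarrow> (complex \<Rightarrow> complex) \<Rightarrow> complex" where
  "hardy_inner f g =
     Lim (at_left (1::real))
       (\<lambda>r. integral {0..2*pi} (\<lambda>t. f (rcis r t) * cnj (g (rcis r t))) / of_real (2*pi))"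

definition hardy_orthogonal_complement ::
    "(complex \<Rightarrow> complex) set \<Rightarrow> (complex \<Rightarrow> complex) set" where
  "hardy_orthogonal_complement S = {f \<in> hardy_space2. \<forall>g\<in>S. hardy_inner f g = 0}"

definition blaschke_sequence :: "(nat \<Rightarrow> complex) \<Rightarrow> bool" where
  "blaschke_sequence a \<longleftrightarrow>
     (\<forall>n. 0 < cmod (a n) \<and> cmod (a n) < 1) \<and> summable (\<lambda>n. 1 - cmod (a n))"

text \<open>
  The library's infinite product tolerates finitely many vanishing factors (its value
  is then 0), so this is also right at the points \<open>a n\<close>.
\<close>

definition blaschke_product :: "(nat \<Rightarrow> complex) \<Rightarrow> complex \<Rightarrow> complex" where
  "blaschke_product a z =
     (\<Prod>n. cnj (a n) / of_real (cmod (a n)) * ((a n - z) / (1 - cnj (a n) * z)))"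

definition model_space :: "(complex \<Rightarrow> complex) \<Rightarrow> (complex \<Rightarrow> complex) set" where
  "model_space B = hardy_orthogonal_complement ((\<lambda>g z. B z * g z) ` hardy_space2)"

end

theory Submission
  imports Defs
begin

text \<open>
  Let \<open>f\<close> lie in the model space. Splitting off the component along the reproducing kernel at \<open>a 0\<close>
  and dividing what is left, which vanishes at \<open>a 0\<close>, by the Blaschke factor of \<open>a 0\<close> gives a new
  function in \<open>H\<^sup>2\<close>, to which the same is done at \<open>a 1\<close>, and so on
  (\<open>blaschke_division_step\<close>). After \<open>N\<close> steps \<open>f\<close> is the sum of \<open>N\<close> terms of its expansion in the
  Takenaka--Malmquist--Walsh basis, and of a remainder \<open>B\<^sub>N F\<^sub>N\<close>, where \<open>B\<^sub>N\<close> is the product of the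
  first \<open>N\<close> factors. Orthogonality of \<open>f\<close> to \<open>B H\<^sup>2\<close> means that \<open>F\<^sub>N\<close> is orthogonal to the multiples of
  the tail of \<open>B\<close>. As the tail tends to 1 locally uniformly, \<open>F\<^sub>N\<close> tends to 0
  (\<open>orthogonal_to_multiples_bound\<close>), and \<open>f'\<close> is the limit of the derivatives of the partial sums
  (\<open>malmquist_remainder_deriv\<close>).

  Each basis function is \<open>sqrt (1 - |a n|\<^sup>2) / (1 - cnj (a n) z)\<close> times a function bounded by 1, so
  Cauchy's estimate bounds its derivative by
  \<open>4 sqrt (1 - |a n|\<^sup>2) / ((1 - |z|) |1 - cnj (a n) z|)\<close>. Since \<open>p < 1\<close>, the \<open>p\<close>-th power of a sum is at
  most the sum of the \<open>p\<close>-th powers, and the integral of \<open>|f'|\<^sup>p\<close> with weight \<open>(1 - |z|)\<close> to the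
  power \<open>\<alpha>\<close> is bounded by a series. Its terms contain the integrals of
  \<open>(1 - |z|)\<close> to the power \<open>\<alpha> - p\<close> times \<open>|1 - cnj (a n) z|\<close> to the power \<open>- p\<close>, which are bounded
  uniformly in \<open>n\<close> because \<open>p - \<alpha> < 1\<close> and \<open>p < 1\<close> (\<open>disc_kernel_integral_bounded\<close>). What remains is
  the sum of \<open>|c n|\<^sup>p\<close> times the power \<open>p/2\<close> of \<open>1 - |a n|\<^sup>2\<close>, with square-summable coefficients
  \<open>c n\<close>. By Young's inequality it converges under the hypothesis on the zeros
  (\<open>malmquist_coefficients_summable\<close>).
\<close>

section \<open>The inner product of the Hardy space\<close>

definition circle_inner :: "real \<Rightarrow> (complex \<Rightarrow> complex) \<Rightarrow> (complex \<Rightarrow> complex) \<Rightarrow> complex" where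
  "circle_inner r f g =
     integral {0..2*pi} (\<lambda>t. f (rcis r t) * cnj (g (rcis r t))) / of_real (2*pi)"

definition taylor_coeff :: "(complex \<Rightarrow> complex) \<Rightarrow> nat \<Rightarrow> complex" where
  "taylor_coeff f n = (deriv ^^ n) f 0 / fact n"

lemma continuous_on_circle:
  assumes "f holomorphic_on unit_disc" "0 < r" "r < 1"
  shows "continuous_on A (\<lambda>t. f (rcis r t))"
proof -
  have "continuous_on unit_disc f"
    using assms holomorphic_on_imp_continuous_on by blast
  then show ?thesis
    by (rule continuous_on_compose2) (use assms in \<open>auto intro!: continuous_intros simp: rcis_def norm_mult\<close>)
qed

lemma integrable_on_circle:
  assumes "f holomorphic_on unit_disc" "g holomorphic_on unit_disc" "0 < r" "r < 1"
  shows "(\<lambda>t. f (rcis r t) * cnj (g (rcis r t))) integrable_on {0..2*pi}"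
  by (intro integrable_continuous_real continuous_intros continuous_on_circle assms)

lemma circle_inner_add_left:
  assumes "f holomorphic_on unit_disc" "g holomorphic_on unit_disc" "h holomorphic_on unit_disc"
    "0 < r" "r < 1"
  shows "circle_inner r (\<lambda>z. f z + g z) h = circle_inner r f h + circle_inner r g h"
  using integrable_on_circle[of f h r] integrable_on_circle[of g h r] assms
  by (simp add: circle_inner_def distrib_right integral_add add_divide_distrib)

lemma circle_inner_scale_left:
  "circle_inner r (\<lambda>z. c * f z) h = c * circle_inner r f h"
  by (simp add: circle_inner_def mult.assoc)

lemma circle_inner_commute: "circle_inner r g f = cnj (circle_inner r f g)"
  by (simp add: circle_inner_def integral_cnj mult.commute)

lemma circle_inner_self:
  assumes "f holomorphic_on unit_disc" "0 < r" "r < 1"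
  shows "circle_inner r f f = of_real (integral {0..2*pi} (\<lambda>t. (cmod (f (rcis r t)))\<^sup>2) / (2*pi))"
proof -
  have "(\<lambda>t. (cmod (f (rcis r t)))\<^sup>2) integrable_on {0..2*pi}"
    by (intro integrable_continuous_real continuous_intros continuous_on_circle assms)
  then have "((\<lambda>t. of_real ((cmod (f (rcis r t)))\<^sup>2) :: complex) has_integral
        of_real (integral {0..2*pi} (\<lambda>t. (cmod (f (rcis r t)))\<^sup>2))) {0..2*pi}"
    by (intro has_integral_of_real integrable_integral)
  then have "integral {0..2*pi} (\<lambda>t. of_real ((cmod (f (rcis r t)))\<^sup>2) :: complex)
      = of_real (integral {0..2*pi} (\<lambda>t. (cmod (f (rcis r t)))\<^sup>2))"
    by (rule integral_unique)
  then show ?thesis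
    unfolding circle_inner_def complex_norm_square[symmetric] by simp
qed

lemma cnj_rcis_eq: "r > 0 \<Longrightarrow> cnj (rcis r t) = of_real (r\<^sup>2) / rcis r t"
  by (simp add: rcis_def cis_cnj field_simps power2_eq_square cis_mult flip: cis_inverse)

text \<open>
  On the circle of radius \<open>r\<close> one has \<open>dz = \<i> z dt\<close>, so this is Cauchy's formula for the
  derivatives at \<open>w\<close>, written as an integral over the angle.
\<close>

lemma circle_integral_cauchy:
  fixes f :: "complex \<Rightarrow> complex"
  assumes "f holomorphic_on unit_disc" "0 < r" "r < 1" "w \<in> ball 0 r"
  shows "((\<lambda>t. f (rcis r t) * (rcis r t / (rcis r t - w) ^ Suc k)) has_integral
            2 * pi * ((deriv ^^ k) f w / fact k)) {0..2*pi}"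
proof -
  have sub: "cball 0 r \<subseteq> unit_disc" "ball 0 r \<subseteq> unit_disc" using assms by auto
  have "((\<lambda>u. f u / (u - w) ^ Suc k) has_contour_integral
           (2 * pi * \<i>) / fact k * (deriv ^^ k) f w) (circlepath 0 r)"
    by (rule Cauchy_has_contour_integral_higher_derivative_circlepath)
       (use assms sub holomorphic_on_subset holomorphic_on_imp_continuous_on in blast)+
  then have "((\<lambda>t. f (0 + r * cis t) / (0 + r * cis t - w) ^ Suc k * r * \<i> * cis t) has_integral
      (2 * pi * \<i>) / fact k * (deriv ^^ k) f w) {0..2*pi}"
    unfolding circlepath_def by (subst (asm) has_contour_integral_part_circlepath_iff) auto
  from has_integral_mult_right[OF this, of "-\<i>"] show ?thesis
    by (simp add: rcis_def algebra_simps)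
qed

lemma circle_inner_monomial:
  assumes "f holomorphic_on unit_disc" "0 < r" "r < 1"
  shows "circle_inner r f (\<lambda>z. z ^ n) = taylor_coeff f n * of_real (r ^ (2*n))"
proof -
  have "((\<lambda>t. f (rcis r t) * (rcis r t / (rcis r t - 0) ^ Suc n)) has_integral
            2 * pi * ((deriv ^^ n) f 0 / fact n)) {0..2*pi}"
    by (rule circle_integral_cauchy) (use assms in auto)
  from has_integral_mult_left[OF this, of "of_real (r ^ (2*n))"]
  have "((\<lambda>t. f (rcis r t) * (rcis r t / (rcis r t) ^ Suc n) * of_real (r ^ (2*n))) has_integral
            2 * pi * taylor_coeff f n * of_real (r ^ (2*n))) {0..2*pi}"
    by (simp add: taylor_coeff_def)
  moreover have "f (rcis r t) * (rcis r t / (rcis r t) ^ Suc n) * of_real (r ^ (2*n))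
      = f (rcis r t) * cnj (rcis r t ^ n)" for t
  proof -
    have "z / z ^ Suc n = 1 / z ^ n" if "z \<noteq> 0" for z :: complex
      using that by simp
    then have "rcis r t / rcis r t ^ Suc n = 1 / rcis r t ^ n"
      using assms by (auto simp del: power_Suc)
    moreover have "cnj (rcis r t ^ n) = of_real (r ^ (2*n)) / rcis r t ^ n"
      using assms by (simp only: complex_cnj_power cnj_rcis_eq power_divide power_mult of_real_power)
    ultimately show ?thesis by (simp only:) simp
  qed
  ultimately have "((\<lambda>t. f (rcis r t) * cnj (rcis r t ^ n)) has_integral
            2 * pi * taylor_coeff f n * of_real (r ^ (2*n))) {0..2*pi}"
    by (simp only:)
  then show ?thesis
    by (simp add: circle_inner_def integral_unique)
qed

lemma taylor_sums:
  assumes "f holomorphic_on unit_disc" "z \<in> unit_disc"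
  shows "(\<lambda>n. taylor_coeff f n * z ^ n) sums f z"
  using holomorphic_power_series[OF assms] by (simp add: taylor_coeff_def)

text \<open>
  The monomials are orthogonal on every circle about the origin, and the Taylor series of \<open>g\<close>
  converges uniformly there, so it may be integrated term by term.
\<close>

lemma parseval_circle:
  assumes f: "f holomorphic_on unit_disc" and g: "g holomorphic_on unit_disc" and r: "0 < r" "r < 1"
  shows "(\<lambda>n. taylor_coeff f n * cnj (taylor_coeff g n) * of_real (r ^ (2*n))) sums circle_inner r f g"
proof -
  define b where "b = taylor_coeff g"
  obtain s where s: "r < s" "s < 1" using r dense by blast
  have b_sum: "summable (\<lambda>n. norm (b n * of_real r ^ n))"
  proof (rule powser_insidea)
    show "summable (\<lambda>n. b n * of_real s ^ n)"
      using taylor_sums[OF g, of "of_real s"] s r by (auto simp: b_def sums_iff)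
  qed (use r s in auto)
  have "bounded ((\<lambda>t. f (rcis r t)) ` {0..2*pi})"
    by (intro compact_imp_bounded compact_continuous_image continuous_on_circle f r) auto
  then obtain C where C: "\<And>t. t \<in> {0..2*pi} \<Longrightarrow> norm (f (rcis r t)) \<le> C"
    unfolding bounded_iff by blast
  have unif: "uniform_limit {0..2*pi} (\<lambda>N t. \<Sum>n<N. f (rcis r t) * cnj (b n * rcis r t ^ n))
      (\<lambda>t. \<Sum>n. f (rcis r t) * cnj (b n * rcis r t ^ n)) sequentially"
  proof (rule Weierstrass_m_test)
    show "summable (\<lambda>n. C * norm (b n * of_real r ^ n))"
      by (intro summable_mult b_sum)
    show "norm (f (rcis r t) * cnj (b n * rcis r t ^ n)) \<le> C * norm (b n * of_real r ^ n)"
      if "t \<in> {0..2*pi}" for n t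
      using C[OF that] r by (auto simp: norm_mult norm_power intro!: mult_right_mono)
  qed
  have suminf: "(\<Sum>n. f (rcis r t) * cnj (b n * rcis r t ^ n)) = f (rcis r t) * cnj (g (rcis r t))" for t
  proof -
    have "(\<lambda>n. b n * rcis r t ^ n) sums g (rcis r t)"
      unfolding b_def by (rule taylor_sums[OF g]) (use r in auto)
    then have "(\<lambda>n. f (rcis r t) * cnj (b n * rcis r t ^ n)) sums (f (rcis r t) * cnj (g (rcis r t)))"
      by (intro sums_mult) (simp only: sums_cnj)
    then show ?thesis by (simp add: sums_iff)
  qed
  obtain I J where I: "\<And>N. ((\<lambda>t. \<Sum>n<N. f (rcis r t) * cnj (b n * rcis r t ^ n)) has_integral I N) {0..2*pi}"
    and J: "((\<lambda>t. \<Sum>n. f (rcis r t) * cnj (b n * rcis r t ^ n)) has_integral J) {0..2*pi}"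
    and IJ: "I \<longlonglongrightarrow> J"
  proof (rule uniform_limit_integral[OF unif])
    show "continuous_on {0..2*pi} (\<lambda>t. \<Sum>n<N. f (rcis r t) * cnj (b n * rcis r t ^ n))" for N
      by (intro continuous_intros continuous_on_circle f r continuous_on_circle[where f = "\<lambda>z. z"]) auto
  qed auto
  have mono_int: "((\<lambda>t. f (rcis r t) * cnj (b n * rcis r t ^ n)) has_integral
        of_real (2*pi) * (taylor_coeff f n * cnj (b n) * of_real (r ^ (2*n)))) {0..2*pi}" for n
  proof -
    have "circle_inner r f (\<lambda>z. b n * z ^ n) = cnj (b n) * (taylor_coeff f n * of_real (r ^ (2*n)))"
      using circle_inner_scale_left[of r "b n" "\<lambda>z. z ^ n" f] circle_inner_commute[of r f]
        circle_inner_monomial[OF f r] by simp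
    then have "integral {0..2*pi} (\<lambda>t. f (rcis r t) * cnj (b n * rcis r t ^ n)) =
        of_real (2*pi) * (taylor_coeff f n * cnj (b n) * of_real (r ^ (2*n)))"
      by (simp add: circle_inner_def field_simps)
    with integrable_integral[OF integrable_on_circle[OF f _ r, of "\<lambda>z. b n * z ^ n"]]
    show ?thesis by (simp only: holomorphic_intros)
  qed
  have "I = (\<lambda>N. \<Sum>n<N. of_real (2*pi) * (taylor_coeff f n * cnj (b n) * of_real (r ^ (2*n))))"
    by (rule ext, rule has_integral_unique[OF I has_integral_sum[OF _ mono_int]]) auto
  then have "(\<lambda>n. of_real (2*pi) * (taylor_coeff f n * cnj (b n) * of_real (r ^ (2*n)))) sums J"
    using IJ unfolding sums_def by (simp only:)
  moreover have "circle_inner r f g = J / of_real (2*pi)"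
    using integral_unique[OF J] unfolding suminf circle_inner_def by (simp only:)
  ultimately have "(\<lambda>n. of_real (2*pi) * (taylor_coeff f n * cnj (b n) * of_real (r ^ (2*n))) / of_real (2*pi))
       sums circle_inner r f g"
    by (simp only: sums_divide)
  then show ?thesis by (simp add: b_def)
qed

lemma hardy_space2_iff:
  "f \<in> hardy_space2 \<longleftrightarrow> f holomorphic_on unit_disc \<and>
     (\<exists>C. \<forall>r. 0 < r \<and> r < 1 \<longrightarrow> Re (circle_inner r f f) \<le> C)"
proof (cases "f holomorphic_on unit_disc")
  case True
  define m where "m r = integral {0..2*pi} (\<lambda>t. (cmod (f (rcis r t)))\<^sup>2) / (2*pi)" for r
  have m: "Re (circle_inner r f f) = m r" if "0 < r" "r < 1" for r
    using circle_inner_self[OF True that] by (simp add: m_def)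
  have "bdd_above ((\<lambda>r. sqrt (m r)) ` {0<..<1}) \<longleftrightarrow> (\<exists>C. \<forall>r. 0 < r \<and> r < 1 \<longrightarrow> m r \<le> C)"
  proof
    assume "bdd_above ((\<lambda>r. sqrt (m r)) ` {0<..<1})"
    then obtain C where "\<forall>r\<in>{0<..<1}. sqrt (m r) \<le> C"
      by (auto simp: bdd_above_def)
    then have "\<And>r. 0 < r \<Longrightarrow> r < 1 \<Longrightarrow> m r \<le> C\<^sup>2"
      using sqrt_le_D by auto
    then show "\<exists>C. \<forall>r. 0 < r \<and> r < 1 \<longrightarrow> m r \<le> C" by blast
  next
    assume "\<exists>C. \<forall>r. 0 < r \<and> r < 1 \<longrightarrow> m r \<le> C"
    then obtain C where "\<And>r. 0 < r \<Longrightarrow> r < 1 \<Longrightarrow> m r \<le> C" by blast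
    then show "bdd_above ((\<lambda>r. sqrt (m r)) ` {0<..<1})"
      by (intro bdd_aboveI[of _ "sqrt C"]) auto
  qed
  then show ?thesis using True m unfolding hardy_space2_def m_def by auto
qed (simp add: hardy_space2_def)

lemma hardy_space2_holomorphic: "f \<in> hardy_space2 \<Longrightarrow> f holomorphic_on unit_disc"
  by (simp add: hardy_space2_iff)

lemma eventually_radius_at_left_1: "eventually (\<lambda>r::real. 0 < r \<and> r < 1) (at_left 1)"
  using eventually_at_left_real[of 0 1] by (auto elim: eventually_mono)

text \<open>
  Each partial sum at radius \<open>r\<close> stays below the Hardy bound; \<open>r\<close> tends to 1 with the number of
  terms fixed.
\<close>

lemma square_summable_taylor_coeff:
  assumes "f \<in> hardy_space2"
  shows "summable (\<lambda>n. (cmod (taylor_coeff f n))\<^sup>2)"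
proof -
  have f: "f holomorphic_on unit_disc" using assms by (rule hardy_space2_holomorphic)
  obtain C where C: "\<And>r. 0 < r \<Longrightarrow> r < 1 \<Longrightarrow> Re (circle_inner r f f) \<le> C"
    using assms by (auto simp: hardy_space2_iff)
  have part: "(\<Sum>n<N. (cmod (taylor_coeff f n))\<^sup>2 * r ^ (2*n)) \<le> C" if r: "0 < r" "r < 1" for r N
  proof -
    have "(\<lambda>n. Re (taylor_coeff f n * cnj (taylor_coeff f n) * of_real (r ^ (2*n)))) sums Re (circle_inner r f f)"
      by (intro sums_Re parseval_circle f r)
    then have s: "(\<lambda>n. (cmod (taylor_coeff f n))\<^sup>2 * r ^ (2*n)) sums Re (circle_inner r f f)"
      by (simp only: complex_norm_square[symmetric] of_real_mult[symmetric] Re_complex_of_real)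
    have "(\<Sum>n<N. (cmod (taylor_coeff f n))\<^sup>2 * r ^ (2*n)) \<le> Re (circle_inner r f f)"
      unfolding sums_unique[OF s] using s r by (intro sum_le_suminf) (auto simp: sums_iff)
    with C[OF r] show ?thesis by simp
  qed
  have "(\<Sum>n<N. (cmod (taylor_coeff f n))\<^sup>2) \<le> C" for N
  proof (rule tendsto_upperbound)
    have "((\<lambda>r. \<Sum>n<N. (cmod (taylor_coeff f n))\<^sup>2 * r ^ (2*n)) \<longlongrightarrow>
        (\<Sum>n<N. (cmod (taylor_coeff f n))\<^sup>2 * 1 ^ (2*n))) (at_left 1)"
      by (intro tendsto_intros)
    then show "((\<lambda>r. \<Sum>n<N. (cmod (taylor_coeff f n))\<^sup>2 * r ^ (2*n)) \<longlongrightarrow>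
        (\<Sum>n<N. (cmod (taylor_coeff f n))\<^sup>2)) (at_left 1)" by simp
    show "\<forall>\<^sub>F r in at_left 1. (\<Sum>n<N. (cmod (taylor_coeff f n))\<^sup>2 * r ^ (2*n)) \<le> C"
      using eventually_radius_at_left_1 by eventually_elim (use part in auto)
  qed simp
  then show ?thesis by (intro summableI_nonneg_bounded[of _ C]) auto
qed

lemma hardy_inner_eqI:
  "((\<lambda>r. circle_inner r f g) \<longlongrightarrow> L) (at_left 1) \<Longrightarrow> hardy_inner f g = L"
  unfolding hardy_inner_def circle_inner_def by (intro tendsto_Lim) auto

text \<open>
  The inner product is a value of \<open>Lim\<close>, hence carries information only once the limit is known
  to exist. Parseval turns it into the limit of a power series in \<open>r\<^sup>2\<close> whose terms are dominated
  by a summable sequence that does not depend on \<open>r\<close>. All algebraic laws of the inner product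
  are then inherited from the circles.
\<close>

lemma tendsto_hardy_inner:
  assumes "f \<in> hardy_space2" "g \<in> hardy_space2"
  shows "((\<lambda>r. circle_inner r f g) \<longlongrightarrow> hardy_inner f g) (at_left 1)"
proof -
  note hol = assms[THEN hardy_space2_holomorphic]
  define c where "c n = taylor_coeff f n * cnj (taylor_coeff g n)" for n
  define M where "M n = (cmod (taylor_coeff f n))\<^sup>2 + (cmod (taylor_coeff g n))\<^sup>2" for n
  have cM: "norm (c n * of_real (r ^ (2*n))) \<le> M n" if "0 < r" "r < 1" for n and r :: real
  proof -
    have "norm (c n * of_real (r ^ (2*n))) \<le> norm (c n) * 1"
      unfolding norm_mult using that by (intro mult_left_mono) (auto simp: norm_power power_le_one)
    also have "\<dots> = cmod (taylor_coeff f n) * cmod (taylor_coeff g n)"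
      by (simp add: c_def norm_mult)
    also have "\<dots> \<le> M n"
    proof -
      have "0 \<le> cmod (taylor_coeff f n) * cmod (taylor_coeff g n)" by simp
      then show ?thesis
        using sum_squares_bound[of "cmod (taylor_coeff f n)" "cmod (taylor_coeff g n)"]
        unfolding M_def by linarith
    qed
    finally show ?thesis .
  qed
  have "((\<lambda>r::real. \<Sum>n. c n * of_real (r ^ (2*n))) \<longlongrightarrow> (\<Sum>n. c n * of_real (1 ^ (2*n)))) (at_left 1)"
  proof (rule tannerys_theorem[THEN conjunct2, THEN conjunct2])
    show "\<forall>\<^sub>F (k, r::real) in at_top \<times>\<^sub>F at_left 1. norm (c k * of_real (r ^ (2 * k))) \<le> M k"
      using eventually_prodI[OF eventually_True eventually_radius_at_left_1]
      by (rule eventually_mono) (use cM in auto)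
    show "summable M"
      unfolding M_def by (intro summable_add square_summable_taylor_coeff assms)
  qed (auto intro!: tendsto_eq_intros)
  moreover have "\<forall>\<^sub>F r in at_left 1. (\<Sum>n. c n * of_real (r ^ (2*n))) = circle_inner r f g"
    using eventually_radius_at_left_1
    by eventually_elim (use parseval_circle[OF hol] in \<open>auto simp: sums_iff c_def\<close>)
  ultimately have "((\<lambda>r. circle_inner r f g) \<longlongrightarrow> (\<Sum>n. c n * of_real (1 ^ (2*n)))) (at_left 1)"
    by (rule Lim_transform_eventually)
  then show ?thesis using hardy_inner_eqI by (simp only:)
qed

lemma hardy_inner_cong:
  assumes "f \<in> hardy_space2" "g \<in> hardy_space2"
    "\<And>z. z \<in> unit_disc \<Longrightarrow> f z = f' z" "\<And>z. z \<in> unit_disc \<Longrightarrow> g z = g' z"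
  shows "hardy_inner f' g' = hardy_inner f g"
proof (rule hardy_inner_eqI, rule Lim_transform_eventually[OF tendsto_hardy_inner[OF assms(1,2)]])
  show "\<forall>\<^sub>F r in at_left 1. circle_inner r f g = circle_inner r f' g'"
    using eventually_radius_at_left_1
    by eventually_elim (use assms in \<open>simp add: circle_inner_def\<close>)
qed

lemma hardy_inner_commute:
  assumes "f \<in> hardy_space2" "g \<in> hardy_space2"
  shows "hardy_inner g f = cnj (hardy_inner f g)"
  using tendsto_cnj[OF tendsto_hardy_inner[OF assms]]
  by (intro hardy_inner_eqI) (simp add: circle_inner_commute[of _ g f])

lemma hardy_inner_scale_left:
  assumes "f \<in> hardy_space2" "h \<in> hardy_space2"
  shows "hardy_inner (\<lambda>z. c * f z) h = c * hardy_inner f h"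
  using tendsto_mult[OF tendsto_const tendsto_hardy_inner[OF assms]]
  by (intro hardy_inner_eqI) (simp add: circle_inner_scale_left)

lemma hardy_inner_add_left:
  assumes "f \<in> hardy_space2" "g \<in> hardy_space2" "h \<in> hardy_space2"
  shows "hardy_inner (\<lambda>z. f z + g z) h = hardy_inner f h + hardy_inner g h"
proof (rule hardy_inner_eqI, rule Lim_transform_eventually)
  show "((\<lambda>r. circle_inner r f h + circle_inner r g h) \<longlongrightarrow> hardy_inner f h + hardy_inner g h) (at_left 1)"
    by (intro tendsto_add tendsto_hardy_inner assms)
  show "\<forall>\<^sub>F r in at_left 1. circle_inner r f h + circle_inner r g h = circle_inner r (\<lambda>z. f z + g z) h"
    using eventually_radius_at_left_1
    by eventually_elim (use assms in \<open>simp add: circle_inner_add_left hardy_space2_holomorphic\<close>)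
qed

lemma circle_inner_self_nonneg:
  assumes "f holomorphic_on unit_disc" "0 < r" "r < 1"
  shows "0 \<le> Re (circle_inner r f f)"
proof -
  have "0 \<le> integral {0..2*pi} (\<lambda>t. (cmod (f (rcis r t)))\<^sup>2)"
    by (intro Henstock_Kurzweil_Integration.integral_nonneg integrable_continuous_real
        continuous_intros continuous_on_circle assms) auto
  then show ?thesis by (simp add: circle_inner_self assms)
qed

lemma circle_norm_bound:
  assumes f: "f holomorphic_on unit_disc" and g: "g holomorphic_on unit_disc"
    and r: "0 < r" "r < 1" and K: "\<And>z. cmod z = r \<Longrightarrow> (cmod (f z))\<^sup>2 \<le> K * (cmod (g z))\<^sup>2 + L"
  shows "Re (circle_inner r f f) \<le> K * Re (circle_inner r g g) + L"
proof -
  have int: "(\<lambda>t. (cmod (h (rcis r t)))\<^sup>2) integrable_on {0..2*pi}" if "h holomorphic_on unit_disc" for h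
    by (intro integrable_continuous_real continuous_intros continuous_on_circle that r)
  have "(\<lambda>t. K * (cmod (g (rcis r t)))\<^sup>2 + L) integrable_on {0..2*pi}"
    by (intro integrable_continuous_real continuous_intros continuous_on_circle g r)
  with int[OF f] have "integral {0..2*pi} (\<lambda>t. (cmod (f (rcis r t)))\<^sup>2)
     \<le> integral {0..2*pi} (\<lambda>t. K * (cmod (g (rcis r t)))\<^sup>2 + L)"
    using r K by (intro integral_le) auto
  also have "\<dots> = K * integral {0..2*pi} (\<lambda>t. (cmod (g (rcis r t)))\<^sup>2) + L * (2 * pi)"
    using int[OF g] by (subst integral_add)
      (auto intro!: integrable_continuous_real continuous_intros continuous_on_circle g r)
  finally show ?thesis
    using r by (simp add: circle_inner_self f g field_simps)
qed

text \<open>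
  Only the behaviour near the unit circle decides membership, because a holomorphic function is
  bounded on every smaller closed disc.
\<close>

lemma hardy_space2_dominated:
  assumes f: "f holomorphic_on unit_disc" and g: "g \<in> hardy_space2" and R: "R < 1"
    and K: "\<And>z. R < cmod z \<Longrightarrow> cmod z < 1 \<Longrightarrow> cmod (f z) \<le> K * cmod (g z)"
  shows "f \<in> hardy_space2"
proof -
  have hg: "g holomorphic_on unit_disc" using g by (rule hardy_space2_holomorphic)
  obtain C where C: "\<And>r. 0 < r \<Longrightarrow> r < 1 \<Longrightarrow> Re (circle_inner r g g) \<le> C"
    using g by (auto simp: hardy_space2_iff)
  have "cball 0 R \<subseteq> unit_disc" using R by auto
  then have "bounded (f ` cball 0 R)"
    using f by (intro compact_imp_bounded compact_continuous_image holomorphic_on_imp_continuous_on)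
      (auto intro: holomorphic_on_subset)
  then obtain D where D: "\<And>z. z \<in> cball 0 R \<Longrightarrow> cmod (f z) \<le> D"
    unfolding bounded_iff by blast
  have "Re (circle_inner r f f) \<le> K\<^sup>2 * C + D\<^sup>2" if r: "0 < r" "r < 1" for r
  proof -
    have "Re (circle_inner r f f) \<le> K\<^sup>2 * Re (circle_inner r g g) + D\<^sup>2"
    proof (rule circle_norm_bound[OF f hg r])
      fix z :: complex assume z: "cmod z = r"
      show "(cmod (f z))\<^sup>2 \<le> K\<^sup>2 * (cmod (g z))\<^sup>2 + D\<^sup>2"
      proof (cases "r \<le> R")
        case True
        then have "(cmod (f z))\<^sup>2 \<le> D\<^sup>2" using D[of z] z by (intro power_mono) auto
        then show ?thesis using zero_le_power2[of "K * cmod (g z)"] unfolding power_mult_distrib by linarith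
      next
        case False
        then have "(cmod (f z))\<^sup>2 \<le> (K * cmod (g z))\<^sup>2" using K[of z] z r by (intro power_mono) auto
        then show ?thesis by (simp add: power_mult_distrib add_increasing2)
      qed
    qed
    also have "\<dots> \<le> K\<^sup>2 * C + D\<^sup>2" using C[OF r] by (intro add_right_mono mult_left_mono) auto
    finally show ?thesis .
  qed
  then show ?thesis using f by (auto simp: hardy_space2_iff)
qed

lemma hardy_space2_mult_bounded:
  assumes "\<phi> holomorphic_on unit_disc" "\<And>z. z \<in> unit_disc \<Longrightarrow> cmod (\<phi> z) \<le> K" "g \<in> hardy_space2"
  shows "(\<lambda>z. \<phi> z * g z) \<in> hardy_space2"
proof (rule hardy_space2_dominated[of _ g 0])
  show "(\<lambda>z. \<phi> z * g z) holomorphic_on unit_disc"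
    using assms(1) hardy_space2_holomorphic[OF assms(3)] by (rule holomorphic_on_mult)
qed (use assms in \<open>auto simp: norm_mult intro!: mult_right_mono\<close>)

lemma hardy_space2_scale: "g \<in> hardy_space2 \<Longrightarrow> (\<lambda>z. c * g z) \<in> hardy_space2"
  by (rule hardy_space2_mult_bounded[of _ "cmod c"]) auto

lemma hardy_space2_add:
  assumes "f \<in> hardy_space2" "g \<in> hardy_space2"
  shows "(\<lambda>z. f z + g z) \<in> hardy_space2"
proof -
  note hol = assms[THEN hardy_space2_holomorphic]
  obtain C where C: "\<And>r. 0 < r \<Longrightarrow> r < 1 \<Longrightarrow> Re (circle_inner r f f) \<le> C"
    using assms by (auto simp: hardy_space2_iff)
  obtain D where D: "\<And>r. 0 < r \<Longrightarrow> r < 1 \<Longrightarrow> Re (circle_inner r g g) \<le> D"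
    using assms by (auto simp: hardy_space2_iff)
  have "Re (circle_inner r (\<lambda>z. f z + g z) (\<lambda>z. f z + g z)) \<le> 2 * C + 2 * D" if r: "0 < r" "r < 1" for r
  proof -
    have diff: "(\<lambda>z. f z - g z) holomorphic_on unit_disc"
      using hol by (auto intro!: holomorphic_intros)
    have exp: "circle_inner r (\<lambda>z. f z + c * g z) (\<lambda>z. f z + c * g z) =
      circle_inner r f f + c * circle_inner r g f + cnj c * circle_inner r f g + c * cnj c * circle_inner r g g" for c
    proof -
      have cg: "(\<lambda>z. c * g z) holomorphic_on unit_disc" using hol by (auto intro!: holomorphic_intros)
      then have fg: "(\<lambda>z. f z + c * g z) holomorphic_on unit_disc" using hol by (auto intro!: holomorphic_intros)
      have 1: "circle_inner r (\<lambda>z. f z + c * g z) h = circle_inner r f h + c * circle_inner r g h"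
        if "h holomorphic_on unit_disc" for h
        using circle_inner_add_left[OF hol(1) cg that r] by (simp add: circle_inner_scale_left)
      have 2: "circle_inner r h (\<lambda>z. f z + c * g z) = circle_inner r h f + cnj c * circle_inner r h g"
        if "h holomorphic_on unit_disc" for h
        using 1[OF that] circle_inner_commute[of r _ h] by (metis complex_cnj_add complex_cnj_mult complex_cnj_cnj)
      show ?thesis using hol by (simp add: 1 fg 2 algebra_simps)
    qed
    have "0 \<le> Re (circle_inner r (\<lambda>z. f z - g z) (\<lambda>z. f z - g z))"
      by (rule circle_inner_self_nonneg[OF diff(1) r])
    then show ?thesis
      using exp[of 1] exp[of "-1"] C[OF r] D[OF r] by simp
  qed
  then show ?thesis using hol by (auto simp: hardy_space2_iff intro!: holomorphic_intros)
qed

lemma hardy_space2_const: "(\<lambda>z. c) \<in> hardy_space2"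
  by (auto simp: hardy_space2_def image_constant_conv)

lemma hardy_inner_add_right:
  assumes "f \<in> hardy_space2" "g \<in> hardy_space2" "h \<in> hardy_space2"
  shows "hardy_inner h (\<lambda>z. f z + g z) = hardy_inner h f + hardy_inner h g"
  using hardy_inner_add_left[OF assms] hardy_inner_commute[OF hardy_space2_add[OF assms(1,2)] assms(3)]
    hardy_inner_commute[OF assms(1,3)] hardy_inner_commute[OF assms(2,3)] by simp

lemma hardy_inner_scale_right:
  assumes "f \<in> hardy_space2" "h \<in> hardy_space2"
  shows "hardy_inner h (\<lambda>z. c * f z) = cnj c * hardy_inner h f"
  using hardy_inner_scale_left[OF assms] hardy_inner_commute[OF hardy_space2_scale[OF assms(1)] assms(2)]
    hardy_inner_commute[OF assms] by simp

lemma hardy_inner_self_nonneg: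
  assumes "f \<in> hardy_space2"
  shows "0 \<le> Re (hardy_inner f f)"
proof (rule tendsto_lowerbound)
  show "((\<lambda>r. Re (circle_inner r f f)) \<longlongrightarrow> Re (hardy_inner f f)) (at_left 1)"
    by (intro tendsto_Re tendsto_hardy_inner assms)
  show "\<forall>\<^sub>F r in at_left 1. 0 \<le> Re (circle_inner r f f)"
    using eventually_radius_at_left_1
    by eventually_elim (use assms in \<open>simp add: circle_inner_self_nonneg hardy_space2_holomorphic\<close>)
qed simp

lemma hardy_inner_self_real:
  assumes "f \<in> hardy_space2"
  shows "hardy_inner f f = of_real (Re (hardy_inner f f))"
  using hardy_inner_commute[OF assms assms] by (simp add: complex_eq_iff)

lemma hardy_cauchy_schwarz:
  assumes f: "f \<in> hardy_space2" and g: "g \<in> hardy_space2"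
  shows "(cmod (hardy_inner f g))\<^sup>2 \<le> Re (hardy_inner f f) * Re (hardy_inner g g)"
proof -
  define w where "w = hardy_inner f g"
  define x where "x = (cmod w)\<^sup>2"
  define A B where "A = Re (hardy_inner f f)" and "B = Re (hardy_inner g g)"
  have gf: "hardy_inner g f = cnj w" unfolding w_def by (rule hardy_inner_commute[OF f g])
  have key: "0 \<le> A - 2 * s * x + s\<^sup>2 * x * B" for s :: real
  proof -
    \<comment> \<open>the direction of \<open>w\<close> makes both mixed terms real and equal\<close>
    define c where "c = - of_real s * w"
    have cg: "(\<lambda>z. c * g z) \<in> hardy_space2" using g by (rule hardy_space2_scale)
    have fcg: "(\<lambda>z. f z + c * g z) \<in> hardy_space2" by (intro hardy_space2_add f cg)
    have "hardy_inner (\<lambda>z. f z + c * g z) (\<lambda>z. f z + c * g z) =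
        hardy_inner f f + cnj c * w + c * cnj w + c * cnj c * hardy_inner g g"
      using f g cg fcg
      by (simp add: hardy_inner_add_left hardy_inner_add_right hardy_inner_scale_left
          hardy_inner_scale_right gf algebra_simps flip: w_def)
    also have "c * cnj w = - of_real s * (w * cnj w)" by (simp add: c_def)
    also have "cnj c * w = - of_real s * (w * cnj w)" by (simp add: c_def)
    also have "c * cnj c = of_real s ^ 2 * (w * cnj w)" by (simp add: c_def power2_eq_square)
    also have "w * cnj w = of_real x" by (simp only: x_def complex_norm_square)
    finally have "Re (hardy_inner (\<lambda>z. f z + c * g z) (\<lambda>z. f z + c * g z)) = A - 2 * s * x + s\<^sup>2 * x * B"
      using hardy_inner_self_real[OF f] hardy_inner_self_real[OF g]
      by (simp add: A_def B_def flip: of_real_power of_real_mult)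
    then show ?thesis using hardy_inner_self_nonneg[OF fcg] by simp
  qed
  have "B \<ge> 0" unfolding B_def by (rule hardy_inner_self_nonneg[OF g])
  have "x \<le> A * B"
  proof (cases "B = 0")
    case True
    have "x \<le> 0"
    proof (rule ccontr)
      assume "\<not> x \<le> 0"
      then show False using key[of "(A + 1) / (2 * x)"] True hardy_inner_self_nonneg[OF f]
        by (simp add: A_def)
    qed
    then show ?thesis using True by simp
  next
    case False
    then show ?thesis using \<open>B \<ge> 0\<close> key[of "1 / B"] by (simp add: field_simps power2_eq_square)
  qed
  then show ?thesis by (simp add: x_def A_def B_def w_def)
qed

lemma hardy_inner_mult_contraction:
  assumes "\<phi> holomorphic_on unit_disc" "\<And>z. z \<in> unit_disc \<Longrightarrow> cmod (\<phi> z) \<le> 1" "g \<in> hardy_space2"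
  shows "Re (hardy_inner (\<lambda>z. \<phi> z * g z) (\<lambda>z. \<phi> z * g z)) \<le> Re (hardy_inner g g)"
proof (rule tendsto_le)
  let ?h = "\<lambda>z. \<phi> z * g z"
  have h: "?h \<in> hardy_space2" using assms by (rule hardy_space2_mult_bounded)
  show "((\<lambda>r. Re (circle_inner r ?h ?h)) \<longlongrightarrow> Re (hardy_inner ?h ?h)) (at_left 1)"
    "((\<lambda>r. Re (circle_inner r g g)) \<longlongrightarrow> Re (hardy_inner g g)) (at_left 1)"
    using h assms by (auto intro!: tendsto_Re tendsto_hardy_inner)
  show "\<forall>\<^sub>F r in at_left 1. Re (circle_inner r ?h ?h) \<le> Re (circle_inner r g g)"
    using eventually_radius_at_left_1
  proof eventually_elim
    case (elim r)
    have "Re (circle_inner r ?h ?h) \<le> 1 * Re (circle_inner r g g) + 0"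
      by (rule circle_norm_bound)
         (use elim h assms in \<open>auto intro: hardy_space2_holomorphic simp: norm_mult mult_le_one power_mult_distrib
            intro!: mult_left_le_one_le power_le_one\<close>)
    then show ?case by simp
  qed
qed simp

text \<open>
  A multiplier that is uniformly close to unimodular near the circle changes the integrals over
  the circles of radius \<open>r\<close> by \<open>O(1 - r\<^sup>2)\<close>, so it is an isometry. This replaces the usual
  argument through boundary values.
\<close>

lemma hardy_inner_mult_isometry:
  assumes \<phi>: "\<phi> holomorphic_on unit_disc" "\<And>z. z \<in> unit_disc \<Longrightarrow> cmod (\<phi> z) \<le> 1"
    and K: "\<And>z. z \<in> unit_disc \<Longrightarrow> 1 - (cmod (\<phi> z))\<^sup>2 \<le> K * (1 - (cmod z)\<^sup>2)"
    and f: "f \<in> hardy_space2" and g: "g \<in> hardy_space2"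
  shows "hardy_inner (\<lambda>z. \<phi> z * f z) (\<lambda>z. \<phi> z * g z) = hardy_inner f g"
proof (rule hardy_inner_eqI)
  let ?F = "\<lambda>z. \<phi> z * f z" and ?G = "\<lambda>z. \<phi> z * g z"
  have FG: "?F holomorphic_on unit_disc" "?G holomorphic_on unit_disc"
    using \<phi>(1) f[THEN hardy_space2_holomorphic] g[THEN hardy_space2_holomorphic]
    by (auto intro: holomorphic_on_mult)
  note fg = f[THEN hardy_space2_holomorphic] g[THEN hardy_space2_holomorphic]
  have "((\<lambda>r. circle_inner r ?F ?G - circle_inner r f g) \<longlongrightarrow> 0) (at_left 1)"
  proof (rule Lim_null_comparison)
    let ?E = "\<lambda>r. K * (1 - r\<^sup>2) * (Re (circle_inner r f f) + Re (circle_inner r g g))"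
    have "(?E \<longlongrightarrow> K * (1 - 1\<^sup>2) * (Re (hardy_inner f f) + Re (hardy_inner g g))) (at_left 1)"
      by (intro tendsto_intros tendsto_hardy_inner f g)
    then show "(?E \<longlongrightarrow> 0) (at_left 1)" by simp
    show "\<forall>\<^sub>F r in at_left 1. norm (circle_inner r ?F ?G - circle_inner r f g) \<le> ?E r"
      using eventually_radius_at_left_1
    proof eventually_elim
      case (elim r)
      then have r: "0 < r" "r < 1" by auto
      define d where "d t = ?F (rcis r t) * cnj (?G (rcis r t)) - f (rcis r t) * cnj (g (rcis r t))" for t
      define e where "e t = K * (1 - r\<^sup>2) * ((cmod (f (rcis r t)))\<^sup>2 + (cmod (g (rcis r t)))\<^sup>2)" for t
      have sq: "(\<lambda>t. (cmod (h (rcis r t)))\<^sup>2) integrable_on {0..2*pi}" if "h holomorphic_on unit_disc" for h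
        by (intro integrable_continuous_real continuous_intros continuous_on_circle that r)
      have "norm (integral {0..2*pi} d) \<le> integral {0..2*pi} e"
      proof (rule integral_norm_bound_integral)
        show "d integrable_on {0..2*pi}" "e integrable_on {0..2*pi}"
          unfolding d_def e_def
          by (intro integrable_diff integrable_on_circle FG fg r)
             (intro integrable_continuous_real continuous_intros continuous_on_circle fg r)
        show "norm (d t) \<le> e t" for t
        proof -
          let ?z = "rcis r t"
          have z: "?z \<in> unit_disc" "cmod ?z = r" using r by auto
          have "d t = - (of_real (1 - (cmod (\<phi> ?z))\<^sup>2) * (f ?z * cnj (g ?z)))"
            using complex_norm_square[of "\<phi> ?z"] by (simp add: d_def algebra_simps)
          then have "norm (d t) = \<bar>1 - (cmod (\<phi> ?z))\<^sup>2\<bar> * (cmod (f ?z) * cmod (g ?z))"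
            by (simp only: norm_minus_cancel norm_mult norm_of_real complex_mod_cnj)
          also have "\<dots> \<le> (K * (1 - r\<^sup>2)) * ((cmod (f ?z))\<^sup>2 + (cmod (g ?z))\<^sup>2)"
          proof (rule mult_mono)
            show "\<bar>1 - (cmod (\<phi> ?z))\<^sup>2\<bar> \<le> K * (1 - r\<^sup>2)"
              using \<phi>(2)[OF z(1)] K[OF z(1)] z(2) by (simp add: power_le_one)
            then show "0 \<le> K * (1 - r\<^sup>2)" by linarith
            have "0 \<le> cmod (f ?z) * cmod (g ?z)" by simp
            then show "cmod (f ?z) * cmod (g ?z) \<le> (cmod (f ?z))\<^sup>2 + (cmod (g ?z))\<^sup>2"
              using sum_squares_bound[of "cmod (f ?z)" "cmod (g ?z)"] by linarith
          qed auto
          finally show ?thesis by (simp add: e_def)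
        qed
      qed
      moreover have "circle_inner r ?F ?G - circle_inner r f g = integral {0..2*pi} d / of_real (2*pi)"
        unfolding circle_inner_def d_def
        by (simp only: integral_diff[OF integrable_on_circle[OF FG r] integrable_on_circle[OF fg r]] diff_divide_distrib)
      moreover have "integral {0..2*pi} e / (2*pi) = ?E r"
        unfolding e_def using r
        by (simp add: circle_inner_self fg integral_add[OF sq[OF fg(1)] sq[OF fg(2)]] flip: add_divide_distrib)
      ultimately show ?case
        using divide_right_mono[of "norm (integral {0..2*pi} d)" "integral {0..2*pi} e" "2 * pi"]
        by (simp add: norm_divide)
    qed
  qed
  from tendsto_add[OF this tendsto_hardy_inner[OF f g]]
  show "((\<lambda>r. circle_inner r ?F ?G) \<longlongrightarrow> hardy_inner f g) (at_left 1)" by simp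
qed

section \<open>Reproducing kernels and Blaschke factors\<close>

definition szego_kernel :: "complex \<Rightarrow> complex \<Rightarrow> complex" where
  "szego_kernel w z = 1 / (1 - cnj w * z)"

lemma szego_denominator:
  assumes "cmod w < 1" "cmod z < 1"
  shows "1 - cmod w \<le> cmod (1 - cnj w * z)" "1 - cmod z \<le> cmod (1 - cnj w * z)" "1 - cnj w * z \<noteq> 0"
proof -
  have "1 - cmod (cnj w * z) \<le> cmod (1 - cnj w * z)"
    using norm_triangle_ineq2[of 1 "cnj w * z"] by simp
  moreover have "cmod w * cmod z \<le> cmod w" "cmod w * cmod z \<le> cmod z"
    using assms by (auto intro: mult_left_le mult_left_le_one_le)
  ultimately show *: "1 - cmod w \<le> cmod (1 - cnj w * z)" "1 - cmod z \<le> cmod (1 - cnj w * z)"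
    by (auto simp: norm_mult)
  then show "1 - cnj w * z \<noteq> 0" using assms by auto
qed

lemma szego_kernel_holomorphic: "cmod w < 1 \<Longrightarrow> szego_kernel w holomorphic_on unit_disc"
  unfolding szego_kernel_def using szego_denominator(3) by (auto intro!: holomorphic_intros)

lemma szego_kernel_hardy:
  assumes "cmod w < 1"
  shows "szego_kernel w \<in> hardy_space2"
proof -
  have "(\<lambda>z. szego_kernel w z * 1) \<in> hardy_space2"
  proof (rule hardy_space2_mult_bounded)
    show "cmod (szego_kernel w z) \<le> 1 / (1 - cmod w)" if "z \<in> unit_disc" for z
      using szego_denominator[of w z] assms that by (auto simp: szego_kernel_def norm_divide intro!: frac_le)
  qed (use assms szego_kernel_holomorphic hardy_space2_const in auto)
  then show ?thesis by simp
qed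

text \<open>
  For \<open>|z| = r\<close> the conjugate of \<open>z\<close> is \<open>r\<^sup>2 / z\<close>, so on that circle the conjugated kernel is the
  Cauchy kernel with pole at \<open>r\<^sup>2 w\<close>.
\<close>

lemma szego_reproducing:
  assumes f: "f \<in> hardy_space2" and w: "cmod w < 1"
  shows "hardy_inner f (szego_kernel w) = f w"
proof (rule hardy_inner_eqI, rule Lim_transform_eventually)
  have hf: "f holomorphic_on unit_disc" using f by (rule hardy_space2_holomorphic)
  have "isCont f w"
    using w hf by (metis holomorphic_on_imp_continuous_on continuous_on_eq_continuous_at open_ball mem_ball_0)
  then have "isCont f (of_real (1\<^sup>2) * w)" by simp
  then show "((\<lambda>r. f (of_real (r\<^sup>2) * w)) \<longlongrightarrow> f w) (at_left 1)"
    using tendsto_mult[OF tendsto_of_real[OF tendsto_power[OF tendsto_ident_at[of 1 "{..<1}"], of 2]] tendsto_const[of w]] isCont_tendsto_compose[of "of_real (1\<^sup>2) * w" f "\<lambda>r::real. of_real (r\<^sup>2) * w" "at_left 1"]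
    by simp
  show "\<forall>\<^sub>F r in at_left 1. f (of_real (r\<^sup>2) * w) = circle_inner r f (szego_kernel w)"
    using eventually_radius_at_left_1
  proof eventually_elim
    case (elim r)
    then have r: "0 < r" "r < 1" by auto
    have "r * cmod w < 1" using r w mult_strict_mono[of r 1 "cmod w" 1] by auto
    then have wr: "of_real (r\<^sup>2) * w \<in> ball 0 r"
      using r by (simp add: norm_mult power2_eq_square)
    have "((\<lambda>t. f (rcis r t) * (rcis r t / (rcis r t - of_real (r\<^sup>2) * w) ^ Suc 0)) has_integral
            2 * pi * ((deriv ^^ 0) f (of_real (r\<^sup>2) * w) / fact 0)) {0..2*pi}"
      by (rule circle_integral_cauchy[OF hf r wr])
    moreover have "rcis r t / (rcis r t - of_real (r\<^sup>2) * w) ^ Suc 0 = cnj (szego_kernel w (rcis r t))" for t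
    proof -
      have z: "rcis r t \<noteq> 0" using r by simp
      have "u / (u - s * w) = 1 / (1 - w * (s / u))" if "u \<noteq> 0" for u s
        using that by (cases "u = s * w") (auto simp: field_simps)
      from this[OF z, of "of_real (r\<^sup>2)"] show ?thesis
        using cnj_rcis_eq[of r t] r by (simp add: szego_kernel_def)
    qed
    ultimately have "((\<lambda>t. f (rcis r t) * cnj (szego_kernel w (rcis r t))) has_integral
            2 * pi * f (of_real (r\<^sup>2) * w)) {0..2*pi}"
      by (simp only:) simp
    from integral_unique[OF this] show ?case
      by (simp add: circle_inner_def)
  qed
qed

definition blaschke_factor :: "complex \<Rightarrow> complex \<Rightarrow> complex" where
  "blaschke_factor a z = cnj a / of_real (cmod a) * ((a - z) / (1 - cnj a * z))"

lemma blaschke_factor_norm: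
  assumes a: "0 < cmod a" "cmod a < 1" and z: "cmod z < 1"
  shows "1 - (cmod (blaschke_factor a z))\<^sup>2 = (1 - (cmod a)\<^sup>2) * (1 - (cmod z)\<^sup>2) / (cmod (1 - cnj a * z))\<^sup>2"
proof -
  have "cmod (blaschke_factor a z) = cmod (a - z) / cmod (1 - cnj a * z)"
    using a by (simp add: blaschke_factor_def norm_mult norm_divide)
  moreover have "(cmod (1 - cnj a * z))\<^sup>2 - (cmod (a - z))\<^sup>2 = (1 - (cmod a)\<^sup>2) * (1 - (cmod z)\<^sup>2)"
    unfolding cmod_power2 by (simp add: algebra_simps power2_eq_square)
  ultimately show ?thesis
    using szego_denominator(3)[OF a(2) z] by (simp add: power_divide diff_divide_eq_iff)
qed

lemma blaschke_factor_le_1: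
  assumes "0 < cmod a" "cmod a < 1" "cmod z < 1"
  shows "cmod (blaschke_factor a z) \<le> 1"
proof -
  have "0 \<le> 1 - (cmod (blaschke_factor a z))\<^sup>2"
    unfolding blaschke_factor_norm[OF assms] using assms by (auto simp: power_le_one)
  then show ?thesis using power2_le_imp_le[of "cmod (blaschke_factor a z)" 1] by simp
qed

lemma blaschke_factor_near_circle:
  assumes a: "0 < cmod a" "cmod a < 1" and z: "cmod z < 1"
  shows "1 - (cmod (blaschke_factor a z))\<^sup>2 \<le> 1 / (1 - cmod a)\<^sup>2 * (1 - (cmod z)\<^sup>2)"
proof -
  have "(1 - (cmod a)\<^sup>2) * (1 - (cmod z)\<^sup>2) / (cmod (1 - cnj a * z))\<^sup>2 \<le> 1 * (1 - (cmod z)\<^sup>2) / (1 - cmod a)\<^sup>2"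
    using a z szego_denominator(1)[OF a(2) z]
    by (intro frac_le mult_right_mono power_mono mult_nonneg_nonneg) (auto simp: power_le_one)
  then show ?thesis unfolding blaschke_factor_norm[OF assms] by simp
qed

lemma blaschke_factor_holomorphic: "cmod a < 1 \<Longrightarrow> blaschke_factor a holomorphic_on unit_disc"
  unfolding blaschke_factor_def using szego_denominator(3) by (auto intro!: holomorphic_intros)

lemma hardy_space2_blaschke_mult:
  "0 < cmod a \<Longrightarrow> cmod a < 1 \<Longrightarrow> f \<in> hardy_space2 \<Longrightarrow> (\<lambda>z. blaschke_factor a z * f z) \<in> hardy_space2"
  by (rule hardy_space2_mult_bounded[of _ 1]) (auto intro: blaschke_factor_holomorphic blaschke_factor_le_1)

lemma hardy_inner_blaschke_isometry:
  assumes "0 < cmod a" "cmod a < 1" "f \<in> hardy_space2" "g \<in> hardy_space2"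
  shows "hardy_inner (\<lambda>z. blaschke_factor a z * f z) (\<lambda>z. blaschke_factor a z * g z) = hardy_inner f g"
  by (rule hardy_inner_mult_isometry[of _ "1 / (1 - cmod a)\<^sup>2"])
     (use assms blaschke_factor_holomorphic blaschke_factor_le_1 blaschke_factor_near_circle in auto)

lemma blaschke_factor_zero [simp]: "blaschke_factor a a = 0"
  by (simp add: blaschke_factor_def)

text \<open>
  The Blaschke factor has a single simple zero, which the zero of \<open>N\<close> cancels, and its modulus
  is at least 1/2 near the circle; so dividing by it does not leave the Hardy space.
\<close>

lemma hardy_space2_divide_zero:
  assumes a: "0 < cmod a" "cmod a < 1" and N: "N \<in> hardy_space2" and "N a = 0"
  obtains F where "F \<in> hardy_space2" "\<And>z. z \<in> unit_disc \<Longrightarrow> N z = blaschke_factor a z * F z"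
proof -
  have hN: "N holomorphic_on unit_disc" using N by (rule hardy_space2_holomorphic)
  define Q where "Q z = (if z = a then deriv N a else (N z - N a) / (z - a))" for z
  define F where "F z = - Q z * (1 - cnj a * z) * (of_real (cmod a) / cnj a)" for z
  have Q: "Q holomorphic_on unit_disc" unfolding Q_def using pole_lemma_open[OF hN open_ball] by simp
  then have hF: "F holomorphic_on unit_disc" unfolding F_def by (intro holomorphic_intros)
  have NF: "N z = blaschke_factor a z * F z" if "z \<in> unit_disc" for z
  proof -
    have "N z = (z - a) * Q z" using \<open>N a = 0\<close> by (simp add: Q_def)
    moreover have "u * (v / D) * (- q * D * u') = - (v * q)" if "D \<noteq> 0" "u * u' = 1" for u v D q u' :: complex
      using that by (simp add: field_simps)
    from this[of "1 - cnj a * z" "cnj a / of_real (cmod a)" "of_real (cmod a) / cnj a" "a - z" "Q z"]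
    have "blaschke_factor a z * F z = - ((a - z) * Q z)"
      using a szego_denominator(3)[OF a(2), of z] that unfolding F_def blaschke_factor_def by auto
    ultimately show ?thesis by (simp add: left_diff_distrib)
  qed
  define c where "c = (1 - cmod a)\<^sup>2"
  have c: "0 < c" "c \<le> 1" using a by (auto simp: c_def power_le_one)
  have "F \<in> hardy_space2"
  proof (rule hardy_space2_dominated[OF hF N])
    \<comment> \<open>beyond this radius the factor has modulus at least 1/2\<close>
    show "sqrt (1 - c * (3/4)) < 1" using c by simp
    fix z assume z: "sqrt (1 - c * (3/4)) < cmod z" "cmod z < 1"
    then have "1 - c * (3/4) \<le> (cmod z)\<^sup>2" using sqrt_le_D[of "1 - c * (3/4)" "cmod z"] by simp
    then have "1 / c * (1 - (cmod z)\<^sup>2) \<le> 3/4" using c by (simp add: field_simps)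
    then have "1/4 \<le> (cmod (blaschke_factor a z))\<^sup>2"
      using blaschke_factor_near_circle[OF a z(2)] unfolding c_def by linarith
    then have "(1/2)\<^sup>2 \<le> (cmod (blaschke_factor a z))\<^sup>2"
      by (simp add: power_divide)
    then have "1/2 \<le> cmod (blaschke_factor a z)" by (rule power2_le_imp_le) auto
    then have "1/2 * cmod (F z) \<le> cmod (blaschke_factor a z) * cmod (F z)" by (intro mult_right_mono) auto
    also have "\<dots> = cmod (N z)" using NF[of z] z by (simp add: norm_mult)
    finally show "cmod (F z) \<le> 2 * cmod (N z)" by simp
  qed
  then show ?thesis using that NF by blast
qed

text \<open>
  The functions of the Hardy space that vanish at \<open>a\<close> are the multiples of the Blaschke factor at
  \<open>a\<close>, and their orthogonal complement is spanned by the kernel at \<open>a\<close>. Splitting \<open>f\<close> along this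
  decomposition leaves a quotient \<open>F\<close>, because multiplication by the factor is isometric.
\<close>

lemma blaschke_division_step:
  assumes a: "0 < cmod a" "cmod a < 1" and f: "f \<in> hardy_space2"
  obtains F where "F \<in> hardy_space2"
    "\<And>z. z \<in> unit_disc \<Longrightarrow> f z = f a * of_real (1 - (cmod a)\<^sup>2) * szego_kernel a z + blaschke_factor a z * F z"
    "Re (hardy_inner f f) = (cmod (f a))\<^sup>2 * (1 - (cmod a)\<^sup>2) + Re (hardy_inner F F)"
    "\<And>g. g \<in> hardy_space2 \<Longrightarrow> hardy_inner f (\<lambda>z. blaschke_factor a z * g z) = hardy_inner F g"
proof -
  define c where "c = f a * of_real (1 - (cmod a)\<^sup>2)"
  define k where "k = szego_kernel a"
  have k: "k \<in> hardy_space2" unfolding k_def using a by (intro szego_kernel_hardy)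
  have kaa: "k a = of_real (1 / (1 - (cmod a)\<^sup>2))"
    using complex_norm_square[of a] by (simp add: k_def szego_kernel_def mult.commute)
  have a1: "1 - (cmod a)\<^sup>2 > 0" using a by (simp add: power_less_one_iff abs_square_less_1)
  then have cka: "c * k a = f a" by (simp add: c_def kaa del: of_real_diff flip: of_real_mult)
  obtain F where F: "F \<in> hardy_space2" and FN: "\<And>z. z \<in> unit_disc \<Longrightarrow> f z + (-c) * k z = blaschke_factor a z * F z"
  proof (rule hardy_space2_divide_zero[OF a])
    show "(\<lambda>z. f z + (-c) * k z) \<in> hardy_space2"
      by (intro hardy_space2_add hardy_space2_scale f k)
    show "f a + (-c) * k a = 0" using cka by simp
  qed blast
  have fz: "f z = c * k z + blaschke_factor a z * F z" if "z \<in> unit_disc" for z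
    using FN[OF that] by (simp add: algebra_simps)
  have \<phi>: "(\<lambda>z. blaschke_factor a z * g z) \<in> hardy_space2" if "g \<in> hardy_space2" for g
    using a that by (rule hardy_space2_blaschke_mult)
  have orth: "hardy_inner (\<lambda>z. blaschke_factor a z * g z) k = 0" if "g \<in> hardy_space2" for g
    using szego_reproducing[OF \<phi>[OF that] a(2)] by (simp add: k_def)
  then have orth': "hardy_inner k (\<lambda>z. blaschke_factor a z * g z) = 0" if "g \<in> hardy_space2" for g
    using hardy_inner_commute[OF \<phi>[OF that] k] that by simp
  have ck: "(\<lambda>z. c * k z) \<in> hardy_space2" using k by (rule hardy_space2_scale)
  have sum: "(\<lambda>z. c * k z + blaschke_factor a z * F z) \<in> hardy_space2"
    by (intro hardy_space2_add ck \<phi> F)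
  have inner: "hardy_inner f h = c * hardy_inner k h + hardy_inner (\<lambda>z. blaschke_factor a z * F z) h"
    if h: "h \<in> hardy_space2" for h
  proof -
    have "hardy_inner f h = hardy_inner (\<lambda>z. c * k z + blaschke_factor a z * F z) h"
      by (rule hardy_inner_cong[OF sum h]) (use fz in auto)
    then show ?thesis using h ck k \<phi>[OF F] by (simp add: hardy_inner_add_left hardy_inner_scale_left)
  qed
  have 3: "hardy_inner f (\<lambda>z. blaschke_factor a z * g z) = hardy_inner F g" if g: "g \<in> hardy_space2" for g
    using inner[OF \<phi>[OF g]] orth'[OF g] hardy_inner_blaschke_isometry[OF a F g] by simp
  have "hardy_inner f f = c * hardy_inner k f + hardy_inner (\<lambda>z. blaschke_factor a z * F z) f"
    by (rule inner[OF f])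
  also have "hardy_inner k f = cnj (f a)"
    using hardy_inner_commute[OF f k] szego_reproducing[OF f a(2)] by (simp add: k_def)
  also have "hardy_inner (\<lambda>z. blaschke_factor a z * F z) f = cnj (hardy_inner F F)"
    using hardy_inner_commute[OF f \<phi>[OF F]] 3[OF F] by simp
  also have "c * cnj (f a) = of_real ((cmod (f a))\<^sup>2 * (1 - (cmod a)\<^sup>2))"
    using complex_norm_square[of "f a"] by (simp add: c_def mult_ac)
  finally have "Re (hardy_inner f f) = (cmod (f a))\<^sup>2 * (1 - (cmod a)\<^sup>2) + Re (hardy_inner F F)"
    by simp
  then show ?thesis using that[OF F] fz 3 by (simp add: c_def k_def)
qed

section \<open>Blaschke products as limits of finite products\<close>

lemma blaschke_product_eq: "blaschke_product a z = (\<Prod>n. blaschke_factor (a n) z)"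
  by (simp add: blaschke_product_def blaschke_factor_def)

definition partial_blaschke :: "(nat \<Rightarrow> complex) \<Rightarrow> nat \<Rightarrow> complex \<Rightarrow> complex" where
  "partial_blaschke a N z = (\<Prod>k<N. blaschke_factor (a k) z)"

lemma blaschke_sequence_norm: "blaschke_sequence a \<Longrightarrow> 0 < cmod (a n) \<and> cmod (a n) < 1"
  by (simp add: blaschke_sequence_def)

lemma blaschke_sequence_shift: "blaschke_sequence a \<Longrightarrow> blaschke_sequence (\<lambda>k. a (k + n))"
  by (simp add: blaschke_sequence_def summable_iff_shift[of "\<lambda>n. 1 - cmod (a n)"])

lemma partial_blaschke_holomorphic:
  "blaschke_sequence a \<Longrightarrow> partial_blaschke a N holomorphic_on unit_disc"
  unfolding partial_blaschke_def using blaschke_sequence_norm blaschke_factor_holomorphic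
  by (auto intro!: holomorphic_on_prod)

lemma partial_blaschke_le_1:
  assumes "blaschke_sequence a" "cmod z < 1"
  shows "cmod (partial_blaschke a N z) \<le> 1"
  unfolding partial_blaschke_def prod_norm[symmetric]
  using assms blaschke_sequence_norm blaschke_factor_le_1 by (intro prod_le_1) auto

lemma blaschke_factor_minus_1:
  assumes a: "0 < cmod a" "cmod a < 1" and z: "cmod z < 1"
  shows "cmod (blaschke_factor a z - 1) \<le> 2 / (1 - cmod z) * (1 - cmod a)"
proof -
  define t where "t = cmod a"
  have t: "0 < t" "t < 1" using a by (auto simp: t_def)
  define D where "D = 1 - cnj a * z"
  have D: "D \<noteq> 0" "1 - cmod z \<le> cmod D"
    using szego_denominator[OF a(2) z] by (auto simp: D_def)
  have aa: "cnj a * a = of_real t * of_real t"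
    using complex_norm_square[of a] by (simp add: t_def power2_eq_square mult.commute)
  have num: "cnj a * (a - z) - of_real t * D = - (of_real (1 - t) * (of_real t + cnj a * z))"
    using aa by (simp add: D_def algebra_simps)
  have "blaschke_factor a z - 1 = (cnj a * (a - z) - of_real t * D) / (of_real t * D)"
    using t D(1) unfolding blaschke_factor_def D_def[symmetric] t_def[symmetric]
    by (simp add: divide_simps)
  then have "cmod (blaschke_factor a z - 1) = (1 - t) * cmod (of_real t + cnj a * z) / (t * cmod D)"
    unfolding num using t by (simp add: norm_divide norm_mult del: of_real_diff)
  also have "\<dots> \<le> (1 - t) * (2 * t) / (t * (1 - cmod z))"
  proof (intro frac_le mult_left_mono)
    have "cmod (of_real t + cnj a * z) \<le> t + t * cmod z"
      using norm_triangle_ineq[of "of_real t" "cnj a * z"] t by (simp add: norm_mult t_def)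
    also have "t * cmod z \<le> t" using t z by (simp add: mult_left_le)
    finally show "cmod (of_real t + cnj a * z) \<le> 2 * t" by simp
  qed (use t D z in auto)
  also have "\<dots> = 2 / (1 - cmod z) * (1 - t)" using t z by (auto simp: divide_simps)
  finally show ?thesis by (simp add: t_def)
qed

lemma summable_blaschke_factor_minus_1:
  assumes "blaschke_sequence a" "cmod z < 1"
  shows "summable (\<lambda>n. cmod (blaschke_factor (a n) z - 1))"
proof (rule summable_comparison_test')
  show "summable (\<lambda>n. 2 / (1 - cmod z) * (1 - cmod (a n)))"
    using assms by (intro summable_mult) (simp add: blaschke_sequence_def)
  show "norm (cmod (blaschke_factor (a n) z - 1)) \<le> 2 / (1 - cmod z) * (1 - cmod (a n))" for n
    using blaschke_factor_minus_1[of "a n" z] blaschke_sequence_norm[OF assms(1), of n] assms(2) by simp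
qed

lemma partial_blaschke_LIMSEQ:
  assumes "blaschke_sequence a" "cmod z < 1"
  shows "(\<lambda>N. partial_blaschke a N z) \<longlonglongrightarrow> blaschke_product a z"
proof -
  have "abs_convergent_prod (\<lambda>n. blaschke_factor (a n) z)"
    using summable_blaschke_factor_minus_1[OF assms] by (simp add: abs_convergent_prod_conv_summable)
  then have "(\<lambda>N. \<Prod>k\<le>N. blaschke_factor (a k) z) \<longlonglongrightarrow> blaschke_product a z"
    unfolding blaschke_product_eq by (intro convergent_prod_LIMSEQ abs_convergent_prod_imp_convergent_prod)
  then show ?thesis
    unfolding partial_blaschke_def LIMSEQ_lessThan_iff_atMost[of "\<lambda>A. \<Prod>k\<in>A. blaschke_factor (a k) z"] .
qed

lemma blaschke_product_le_1:
  assumes "blaschke_sequence a" "cmod z < 1"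
  shows "cmod (blaschke_product a z) \<le> 1"
  using tendsto_norm[OF partial_blaschke_LIMSEQ[OF assms]] partial_blaschke_le_1[OF assms]
  by (intro LIMSEQ_le_const2) auto

lemma blaschke_product_Suc:
  assumes "blaschke_sequence a" "cmod z < 1"
  shows "blaschke_product a z = blaschke_factor (a 0) z * blaschke_product (\<lambda>k. a (Suc k)) z"
proof (rule LIMSEQ_unique)
  show "(\<lambda>N. partial_blaschke a (Suc N) z) \<longlonglongrightarrow> blaschke_product a z"
    using partial_blaschke_LIMSEQ[OF assms] by (rule LIMSEQ_Suc)
  have "(\<lambda>N. partial_blaschke (\<lambda>k. a (Suc k)) N z) \<longlonglongrightarrow> blaschke_product (\<lambda>k. a (Suc k)) z"
    using blaschke_sequence_shift[OF assms(1), of 1] assms(2) by (intro partial_blaschke_LIMSEQ) auto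
  from tendsto_mult[OF tendsto_const this, of "blaschke_factor (a 0) z"]
  show "(\<lambda>N. partial_blaschke a (Suc N) z) \<longlonglongrightarrow> blaschke_factor (a 0) z * blaschke_product (\<lambda>k. a (Suc k)) z"
    by (simp add: partial_blaschke_def prod.lessThan_Suc_shift del: prod.lessThan_Suc)
qed

text \<open>
  A tail of the Blaschke sum makes the right-hand side small, uniformly on compact subsets of the
  disc; this is how tails of the product are seen to tend to 1.
\<close>

lemma blaschke_product_minus_1:
  assumes "blaschke_sequence a" "cmod z < 1"
  shows "cmod (blaschke_product a z - 1) \<le> exp (2 / (1 - cmod z) * (\<Sum>n. 1 - cmod (a n))) - 1"
proof (rule LIMSEQ_le_const2)
  show "(\<lambda>N. cmod (partial_blaschke a N z - 1)) \<longlonglongrightarrow> cmod (blaschke_product a z - 1)"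
    by (intro tendsto_intros partial_blaschke_LIMSEQ assms)
  have "cmod (partial_blaschke a N z - 1) \<le> exp (2 / (1 - cmod z) * (\<Sum>n. 1 - cmod (a n))) - 1" for N
  proof -
    have bs: "summable (\<lambda>n. 1 - cmod (a n))" "\<And>n. 0 < cmod (a n)" "\<And>n. cmod (a n) < 1"
      using assms(1) by (auto simp: blaschke_sequence_def)
    have "cmod (partial_blaschke a N z - 1) \<le> (\<Prod>k<N. 1 + cmod (blaschke_factor (a k) z - 1)) - 1"
      using norm_prod_minus1_le_prod_minus1[of "\<lambda>k. blaschke_factor (a k) z - 1" "{..<N}"]
      by (simp add: partial_blaschke_def)
    also have "(\<Prod>k<N. 1 + cmod (blaschke_factor (a k) z - 1)) \<le> exp (\<Sum>k<N. cmod (blaschke_factor (a k) z - 1))"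
      by (rule prod_le_exp_sum) auto
    also have "(\<Sum>k<N. cmod (blaschke_factor (a k) z - 1)) \<le> (\<Sum>k<N. 2 / (1 - cmod z) * (1 - cmod (a k)))"
      using assms(2) bs by (intro sum_mono blaschke_factor_minus_1) auto
    also have "\<dots> = 2 / (1 - cmod z) * (\<Sum>k<N. 1 - cmod (a k))" by (rule sum_distrib_left[symmetric])
    also have "\<dots> \<le> 2 / (1 - cmod z) * (\<Sum>n. 1 - cmod (a n))"
      using assms(2) bs by (intro mult_left_mono sum_le_suminf) (auto simp: less_imp_le)
    finally show ?thesis by simp
  qed
  then show "\<exists>N0. \<forall>N\<ge>N0. cmod (partial_blaschke a N z - 1) \<le> exp (2 / (1 - cmod z) * (\<Sum>n. 1 - cmod (a n))) - 1"
    by blast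
qed

lemma blaschke_product_holomorphic:
  assumes "blaschke_sequence a"
  shows "blaschke_product a holomorphic_on unit_disc"
proof (rule holomorphic_uniform_sequence[OF open_ball partial_blaschke_holomorphic[OF assms]])
  fix x :: complex assume x: "x \<in> unit_disc"
  define s where "s = (1 + cmod x) / 2"
  define d where "d = (1 - cmod x) / 2"
  have d: "0 < d" using x by (simp add: d_def)
  have s: "s < 1" using x by (simp add: s_def)
  have sub: "cmod z \<le> s" if "z \<in> cball x d" for z
  proof -
    have "cmod z \<le> cmod x + cmod (z - x)" using norm_triangle_sub by blast
    then show ?thesis using that by (simp add: s_def d_def dist_norm norm_minus_commute field_simps)
  qed
  then have sub': "cball x d \<subseteq> unit_disc" using s by force
  have "uniformly_convergent_on (cball x d) (\<lambda>N z. partial_blaschke a N z)"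
    unfolding partial_blaschke_def
  proof (rule uniformly_convergent_on_prod')
    show "continuous_on (cball x d) (blaschke_factor (a n))" for n
      using blaschke_factor_holomorphic[of "a n"] blaschke_sequence_norm[OF assms, of n] sub'
      by (intro holomorphic_on_imp_continuous_on) (auto intro: holomorphic_on_subset)
    show "uniformly_convergent_on (cball x d) (\<lambda>N z. \<Sum>n<N. norm (blaschke_factor (a n) z - 1))"
    proof (rule Weierstrass_m_test')
      show "norm (norm (blaschke_factor (a n) z - 1)) \<le> 2 / (1 - s) * (1 - cmod (a n))"
        if z: "z \<in> cball x d" for n z
      proof -
        have an: "0 < cmod (a n)" "cmod (a n) < 1" using blaschke_sequence_norm[OF assms] by auto
        have "cmod (blaschke_factor (a n) z - 1) \<le> 2 / (1 - cmod z) * (1 - cmod (a n))"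
          using sub[OF z] s by (intro blaschke_factor_minus_1 an) auto
        also have "\<dots> \<le> 2 / (1 - s) * (1 - cmod (a n))"
          using sub[OF z] s an by (intro mult_right_mono frac_le) auto
        finally show ?thesis by simp
      qed
      show "summable (\<lambda>n. 2 / (1 - s) * (1 - cmod (a n)))"
        using assms by (intro summable_mult) (simp add: blaschke_sequence_def)
    qed
  qed simp
  then have "uniform_limit (cball x d) (partial_blaschke a) (\<lambda>z. lim (\<lambda>N. partial_blaschke a N z)) sequentially"
    by (simp add: uniformly_convergent_uniform_limit_iff)
  also have "?this \<longleftrightarrow> uniform_limit (cball x d) (partial_blaschke a) (blaschke_product a) sequentially"
  proof (rule uniform_limit_cong')
    show "lim (\<lambda>N. partial_blaschke a N z) = blaschke_product a z" if "z \<in> cball x d" for z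
    proof (rule limI, rule partial_blaschke_LIMSEQ[OF assms])
      show "cmod z < 1" using sub[OF that] s by simp
    qed
  qed simp
  finally show "\<exists>d>0. cball x d \<subseteq> unit_disc \<and>
      uniform_limit (cball x d) (partial_blaschke a) (blaschke_product a) sequentially"
    using d sub' by blast
qed

section \<open>Expansion of functions in the model space\<close>

text \<open>
  \<open>F\<close> is what remains of \<open>f\<close> after its component along the kernel at \<open>a\<close> has been removed and the
  zero at \<open>a\<close> divided out; the second and third clauses are the Pythagorean identity and the
  transfer of orthogonality that belong to this splitting.
\<close>

definition blaschke_quotient :: "complex \<Rightarrow> (complex \<Rightarrow> complex) \<Rightarrow> (complex \<Rightarrow> complex) \<Rightarrow> bool" where
  "blaschke_quotient a f F \<longleftrightarrow>
     (\<forall>z\<in>unit_disc. f z = f a * of_real (1 - (cmod a)\<^sup>2) * szego_kernel a z + blaschke_factor a z * F z) \<and>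
     Re (hardy_inner f f) = (cmod (f a))\<^sup>2 * (1 - (cmod a)\<^sup>2) + Re (hardy_inner F F) \<and>
     (\<forall>g\<in>hardy_space2. hardy_inner f (\<lambda>z. blaschke_factor a z * g z) = hardy_inner F g)"

lemma blaschke_quotients_exist:
  assumes a: "blaschke_sequence a" and f: "f \<in> hardy_space2"
  obtains F where "F 0 = f" "\<And>n. F n \<in> hardy_space2" "\<And>n. blaschke_quotient (a n) (F n) (F (Suc n))"
proof -
  have "\<exists>F. \<forall>n. (F n \<in> hardy_space2 \<and> (n = 0 \<longrightarrow> F n = f)) \<and> blaschke_quotient (a n) (F n) (F (Suc n))"
  proof (rule dependent_nat_choice)
    show "\<exists>g. g \<in> hardy_space2 \<and> ((0::nat) = 0 \<longrightarrow> g = f)" using f by blast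
    fix g and n :: nat assume "g \<in> hardy_space2 \<and> (n = 0 \<longrightarrow> g = f)"
    then have g: "g \<in> hardy_space2" by simp
    have an: "0 < cmod (a n)" "cmod (a n) < 1" using blaschke_sequence_norm[OF a] by auto
    have "\<exists>h. h \<in> hardy_space2 \<and> blaschke_quotient (a n) g h"
      by (rule blaschke_division_step[OF an g]) (unfold blaschke_quotient_def, blast)
    then show "\<exists>h. (h \<in> hardy_space2 \<and> (Suc n = 0 \<longrightarrow> h = f)) \<and> blaschke_quotient (a n) g h" by blast
  qed
  then show ?thesis using that by blast
qed

text \<open>
  When \<open>F\<close> is the sequence of successive quotients of \<open>f\<close>, this is the component of \<open>f\<close> along the
  \<open>n\<close>-th element of the Takenaka--Malmquist--Walsh basis, which is the normalized kernel at \<open>a n\<close>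
  times the Blaschke product of the first \<open>n\<close> zeros.
\<close>

definition malmquist_term :: "(nat \<Rightarrow> complex) \<Rightarrow> (nat \<Rightarrow> complex \<Rightarrow> complex) \<Rightarrow> nat \<Rightarrow> complex \<Rightarrow> complex" where
  "malmquist_term a F n z = F n (a n) * of_real (1 - (cmod (a n))\<^sup>2) * szego_kernel (a n) z * partial_blaschke a n z"

lemma malmquist_expansion:
  assumes "\<And>n. blaschke_quotient (a n) (F n) (F (Suc n))" "z \<in> unit_disc"
  shows "F 0 z = (\<Sum>n<N. malmquist_term a F n z) + partial_blaschke a N z * F N z"
proof (induction N)
  case 0
  show ?case by (simp add: partial_blaschke_def)
next
  case (Suc N)
  have "F N z = F N (a N) * of_real (1 - (cmod (a N))\<^sup>2) * szego_kernel (a N) z + blaschke_factor (a N) z * F (Suc N) z"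
    using assms(1)[of N] assms(2) unfolding blaschke_quotient_def by blast
  then have "partial_blaschke a N z * F N z = malmquist_term a F N z + partial_blaschke a (Suc N) z * F (Suc N) z"
    unfolding malmquist_term_def partial_blaschke_def prod.lessThan_Suc by (simp only: distrib_left mult_ac)
  with Suc show ?case by (simp only: sum.lessThan_Suc add.assoc)
qed

lemma malmquist_norm:
  assumes "\<And>n. blaschke_quotient (a n) (F n) (F (Suc n))"
  shows "Re (hardy_inner (F 0) (F 0)) =
    (\<Sum>n<N. (cmod (F n (a n)))\<^sup>2 * (1 - (cmod (a n))\<^sup>2)) + Re (hardy_inner (F N) (F N))"
proof (induction N)
  case (Suc N)
  then show ?case using assms[of N] by (simp add: blaschke_quotient_def)
qed simp

text \<open>
  Each division strips one factor from the Blaschke product to which the function is orthogonal.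
\<close>

lemma quotient_orthogonal_to_tail:
  assumes a: "blaschke_sequence a" and F0: "F 0 \<in> model_space (blaschke_product a)"
    and F: "\<And>n. F n \<in> hardy_space2" and step: "\<And>n. blaschke_quotient (a n) (F n) (F (Suc n))"
    and g: "g \<in> hardy_space2"
  shows "hardy_inner (F n) (\<lambda>z. blaschke_product (\<lambda>k. a (k + n)) z * g z) = 0"
proof (induction n)
  case 0
  show ?case using F0 g by (simp add: model_space_def hardy_orthogonal_complement_def)
next
  case (Suc n)
  let ?T = "\<lambda>n. blaschke_product (\<lambda>k. a (k + n))"
  have bs: "blaschke_sequence (\<lambda>k. a (k + n))" for n using a by (rule blaschke_sequence_shift)
  have T: "(\<lambda>z. ?T n z * g z) \<in> hardy_space2" for n
    by (rule hardy_space2_mult_bounded[of _ 1])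
       (use bs g in \<open>auto intro: blaschke_product_holomorphic blaschke_product_le_1\<close>)
  have split: "?T n z = blaschke_factor (a n) z * ?T (Suc n) z" if "z \<in> unit_disc" for z
    using blaschke_product_Suc[OF bs, of z n] that by simp
  have an: "0 < cmod (a n)" "cmod (a n) < 1" using blaschke_sequence_norm[OF a] by auto
  have "hardy_inner (F (Suc n)) (\<lambda>z. ?T (Suc n) z * g z)
      = hardy_inner (F n) (\<lambda>z. blaschke_factor (a n) z * (?T (Suc n) z * g z))"
    using step[of n] T[of "Suc n"] by (simp add: blaschke_quotient_def)
  also have "\<dots> = hardy_inner (F n) (\<lambda>z. ?T n z * g z)"
    by (rule hardy_inner_cong[OF F T]) (use split in auto)
  finally show ?case using Suc by simp
qed

text \<open>
  Since \<open>F\<close> is orthogonal to \<open>T H\<^sup>2\<close>, its value at \<open>w\<close> is also its inner product with the kernel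
  of \<open>w\<close> minus \<open>cnj (T w)\<close> times \<open>T\<close> times that kernel. The squared norm of this test function is
  at most \<open>(1 - |T w|\<^sup>2) / (1 - |w|\<^sup>2)\<close>, and Cauchy--Schwarz applies.
\<close>

lemma orthogonal_to_multiples_bound:
  assumes T: "T holomorphic_on unit_disc" "\<And>z. z \<in> unit_disc \<Longrightarrow> cmod (T z) \<le> 1"
    and F: "F \<in> hardy_space2" and orth: "\<And>g. g \<in> hardy_space2 \<Longrightarrow> hardy_inner F (\<lambda>z. T z * g z) = 0"
    and w: "cmod w < 1"
  shows "(cmod (F w))\<^sup>2 \<le> Re (hardy_inner F F) * ((1 - (cmod (T w))\<^sup>2) / (1 - (cmod w)\<^sup>2))"
proof -
  define k where "k = szego_kernel w"
  define Tk where "Tk z = T z * k z" for z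
  define c where "c = - cnj (T w)"
  define \<kappa> where "\<kappa> = 1 / (1 - (cmod w)\<^sup>2)"
  define x where "x = (cmod (T w))\<^sup>2"
  have k: "k \<in> hardy_space2" unfolding k_def using w by (rule szego_kernel_hardy)
  have Tk: "Tk \<in> hardy_space2" unfolding Tk_def using T k by (rule hardy_space2_mult_bounded)
  have cTk: "(\<lambda>z. c * Tk z) \<in> hardy_space2" using Tk by (rule hardy_space2_scale)
  define u where "u z = k z + c * Tk z" for z
  have u: "u \<in> hardy_space2" unfolding u_def by (intro hardy_space2_add k cTk)
  have kw: "k w = of_real \<kappa>"
    using complex_norm_square[of w] by (simp add: k_def szego_kernel_def \<kappa>_def mult.commute)
  have rep: "hardy_inner h k = h w" if "h \<in> hardy_space2" for h
    unfolding k_def using that w by (rule szego_reproducing)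
  have kTk: "hardy_inner k Tk = cnj (T w * of_real \<kappa>)"
    using hardy_inner_commute[OF Tk k] rep[OF Tk] by (simp add: Tk_def kw)
  have Fu: "hardy_inner F u = F w"
    using rep[OF F] orth[OF k] F k Tk cTk unfolding u_def Tk_def
    by (simp add: hardy_inner_add_right hardy_inner_scale_right)
  have "hardy_inner u u = hardy_inner k k + cnj c * hardy_inner k Tk + c * hardy_inner Tk k + c * cnj c * hardy_inner Tk Tk"
    using k Tk cTk u unfolding u_def
    by (simp add: hardy_inner_add_left hardy_inner_add_right hardy_inner_scale_left
        hardy_inner_scale_right hardy_space2_add algebra_simps)
  also have "cnj c * hardy_inner k Tk = - of_real (\<kappa> * x)"
    using complex_norm_square[of "T w"] by (simp add: c_def kTk x_def mult_ac)
  also have "c * hardy_inner Tk k = - of_real (\<kappa> * x)"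
    using complex_norm_square[of "T w"] by (simp add: c_def rep[OF Tk] Tk_def kw x_def mult_ac)
  also have "c * cnj c = of_real x"
    using complex_norm_square[of "T w"] by (simp add: c_def x_def mult_ac)
  also have "hardy_inner k k = of_real \<kappa>" using rep[OF k] kw by simp
  also have "of_real x * hardy_inner Tk Tk = of_real (x * Re (hardy_inner Tk Tk))"
    using hardy_inner_self_real[OF Tk] by simp
  finally have "Re (hardy_inner u u) = \<kappa> - \<kappa> * x - \<kappa> * x + x * Re (hardy_inner Tk Tk)"
    by simp
  moreover have "Re (hardy_inner Tk Tk) \<le> \<kappa>"
    using hardy_inner_mult_contraction[OF T k] rep[OF k] kw unfolding Tk_def by simp
  then have "x * Re (hardy_inner Tk Tk) \<le> x * \<kappa>" by (intro mult_left_mono) (auto simp: x_def)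
  ultimately have "Re (hardy_inner u u) \<le> \<kappa> * (1 - x)" by (simp add: algebra_simps)
  then have "Re (hardy_inner F F) * Re (hardy_inner u u) \<le> Re (hardy_inner F F) * (\<kappa> * (1 - x))"
    by (intro mult_left_mono hardy_inner_self_nonneg F)
  with hardy_cauchy_schwarz[OF F u] show ?thesis by (simp add: Fu \<kappa>_def x_def)
qed

lemma Cauchy_derivative_estimate:
  assumes "h holomorphic_on unit_disc" "cmod z < 1"
    and "\<And>w. cmod (w - z) = (1 - cmod z) / 2 \<Longrightarrow> cmod w < 1 \<Longrightarrow> cmod (h w) \<le> M"
  shows "cmod (deriv h z) \<le> 2 * M / (1 - cmod z)"
proof -
  define r where "r = (1 - cmod z) / 2"
  have r: "0 < r" using assms(2) by (simp add: r_def)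
  have sub: "w \<in> unit_disc" if "w \<in> cball z r" for w
  proof -
    have "cmod w \<le> cmod z + cmod (w - z)" using norm_triangle_sub by blast
    then show ?thesis using that assms(2) by (simp add: r_def dist_norm norm_minus_commute field_simps)
  qed
  have "cmod ((deriv ^^ 1) h z) \<le> fact 1 * M / r ^ 1"
  proof (rule Cauchy_inequality[OF _ _ r])
    show "h holomorphic_on ball z r" using assms(1) sub by (auto intro: holomorphic_on_subset)
    show "continuous_on (cball z r) h"
      using assms(1) sub by (intro holomorphic_on_imp_continuous_on) (auto intro: holomorphic_on_subset)
    show "cmod (h w) \<le> M" if "cmod (z - w) = r" for w
      using assms(3)[of w] sub[of w] that by (simp add: r_def norm_minus_commute dist_norm)
  qed
  then show ?thesis by (simp add: r_def field_simps)
qed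

text \<open>
  On the circle about \<open>z\<close> of radius half the distance of \<open>z\<close> to the boundary, the kernel is at most
  twice its modulus at \<open>z\<close> and the finite Blaschke product is bounded by 1, so Cauchy's
  estimate suffices for the second claim.
\<close>

lemma malmquist_term_deriv:
  assumes a: "blaschke_sequence a" and z: "cmod z < 1"
  shows "malmquist_term a F n holomorphic_on unit_disc"
    "cmod (deriv (malmquist_term a F n) z)
       \<le> 4 * (cmod (F n (a n)) * (1 - (cmod (a n))\<^sup>2)) / ((1 - cmod z) * cmod (1 - cnj (a n) * z))"
proof -
  have an: "0 < cmod (a n)" "cmod (a n) < 1" using blaschke_sequence_norm[OF a] by auto
  show hol: "malmquist_term a F n holomorphic_on unit_disc"
    unfolding malmquist_term_def using a an
    by (intro holomorphic_intros szego_kernel_holomorphic partial_blaschke_holomorphic)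
  define D where "D = cmod (1 - cnj (a n) * z)"
  have D: "1 - cmod z \<le> D" "0 < D" using szego_denominator[OF an(2) z] by (auto simp: D_def)
  define C where "C = cmod (F n (a n)) * (1 - (cmod (a n))\<^sup>2)"
  have C: "0 \<le> C" using an by (simp add: C_def power_le_one)
  have "cmod (deriv (malmquist_term a F n) z) \<le> 2 * (C * 2 / D) / (1 - cmod z)"
  proof (rule Cauchy_derivative_estimate[OF hol z])
    fix w assume w: "cmod (w - z) = (1 - cmod z) / 2" "cmod w < 1"
    have "D \<le> cmod (1 - cnj (a n) * w) + cmod (cnj (a n) * (w - z))"
      unfolding D_def using norm_triangle_ineq[of "1 - cnj (a n) * w" "cnj (a n) * (w - z)"]
      by (simp add: algebra_simps)
    also have "cmod (cnj (a n) * (w - z)) \<le> D / 2"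
    proof -
      have "cmod (a n) * cmod (w - z) \<le> cmod (w - z)" using an by (intro mult_left_le_one_le) auto
      also have "\<dots> \<le> D / 2" unfolding w(1) using D(1) by simp
      finally show ?thesis by (simp only: norm_mult complex_mod_cnj)
    qed
    finally have "D / 2 \<le> cmod (1 - cnj (a n) * w)" by simp
    then have "1 / cmod (1 - cnj (a n) * w) \<le> 1 / (D / 2)" using D(2) by (intro frac_le) auto
    then have s: "cmod (szego_kernel (a n) w) \<le> 2 / D" by (simp add: szego_kernel_def norm_divide)
    have "cmod (of_real (1 - (cmod (a n))\<^sup>2)) = 1 - (cmod (a n))\<^sup>2"
      using an by (simp only: norm_of_real) (simp add: power_le_one)
    then have "cmod (malmquist_term a F n w) = C * cmod (szego_kernel (a n) w) * cmod (partial_blaschke a n w)"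
      by (simp add: malmquist_term_def C_def norm_mult del: of_real_diff)
    also have "\<dots> \<le> C * (2 / D) * 1"
      using C D s partial_blaschke_le_1[OF a w(2)] by (intro mult_mono) auto
    finally show "cmod (malmquist_term a F n w) \<le> C * 2 / D" by simp
  qed
  then show "cmod (deriv (malmquist_term a F n) z)
       \<le> 4 * (cmod (F n (a n)) * (1 - (cmod (a n))\<^sup>2)) / ((1 - cmod z) * cmod (1 - cnj (a n) * z))"
    by (simp add: C_def D_def mult_ac)
qed

text \<open>
  The \<open>N\<close>-th quotient is orthogonal to the multiples of the tail of the Blaschke product, and the
  tail tends to 1 locally uniformly; hence the remainder, and with it its derivative, tends to 0.
  This is where the completeness of the Takenaka--Malmquist--Walsh basis in the model space enters.
\<close>

lemma malmquist_remainder_deriv: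
  assumes a: "blaschke_sequence a" and F0: "F 0 \<in> model_space (blaschke_product a)"
    and F: "\<And>n. F n \<in> hardy_space2" and step: "\<And>n. blaschke_quotient (a n) (F n) (F (Suc n))"
    and z: "cmod z < 1"
  shows "(\<lambda>N. deriv (\<lambda>w. partial_blaschke a N w * F N w) z) \<longlonglongrightarrow> 0"
proof -
  define E where "E = Re (hardy_inner (F 0) (F 0))"
  define s where "s = (1 + cmod z) / 2"
  have s: "0 < s" "s < 1" using z norm_ge_zero[of z] by (auto simp: s_def intro: add_pos_nonneg)
  have s2: "0 < 1 - s\<^sup>2" using s by (simp add: power_less_one_iff abs_square_less_1)
  define \<tau> where "\<tau> N = (\<Sum>n. 1 - cmod (a (n + N)))" for N
  define \<epsilon> where "\<epsilon> N = exp (2 / (1 - s) * \<tau> N) - 1" for N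
  have bs: "blaschke_sequence (\<lambda>k. a (k + N))" for N using a by (rule blaschke_sequence_shift)
  have \<tau>0: "0 \<le> \<tau> N" for N
    unfolding \<tau>_def using bs[of N] by (intro suminf_nonneg) (auto simp: blaschke_sequence_def less_imp_le)
  have sum_a: "summable (\<lambda>n. 1 - cmod (a n))" using a by (simp add: blaschke_sequence_def)
  have "(\<lambda>N. (\<Sum>n. 1 - cmod (a n)) - (\<Sum>n<N. 1 - cmod (a n))) \<longlonglongrightarrow> (\<Sum>n. 1 - cmod (a n)) - (\<Sum>n. 1 - cmod (a n))"
    by (intro tendsto_intros summable_LIMSEQ sum_a)
  then have "\<tau> \<longlonglongrightarrow> 0"
    using suminf_minus_initial_segment[OF sum_a] by (simp add: \<tau>_def[abs_def])
  then have "\<epsilon> \<longlonglongrightarrow> exp (2 / (1 - s) * 0) - 1"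
    unfolding \<epsilon>_def[abs_def] by (intro tendsto_intros)
  then have "(\<lambda>N. 2 * sqrt (E * (2 * \<epsilon> N / (1 - s\<^sup>2))) / (1 - cmod z)) \<longlonglongrightarrow> 2 * sqrt (E * (2 * 0 / (1 - s\<^sup>2))) / (1 - cmod z)"
    using s2 z by (intro tendsto_intros) auto
  then have lim: "(\<lambda>N. 2 * sqrt (E * (2 * \<epsilon> N / (1 - s\<^sup>2))) / (1 - cmod z)) \<longlonglongrightarrow> 0" by simp
  have "cmod (deriv (\<lambda>w. partial_blaschke a N w * F N w) z) \<le> 2 * sqrt (E * (2 * \<epsilon> N / (1 - s\<^sup>2))) / (1 - cmod z)" for N
  proof (rule Cauchy_derivative_estimate[OF _ z])
    show "(\<lambda>w. partial_blaschke a N w * F N w) holomorphic_on unit_disc"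
      using partial_blaschke_holomorphic[OF a] hardy_space2_holomorphic[OF F] by (rule holomorphic_on_mult)
    fix w assume w: "cmod (w - z) = (1 - cmod z) / 2" "cmod w < 1"
    have "cmod w \<le> cmod z + cmod (w - z)" using norm_triangle_sub by blast
    then have ws: "cmod w \<le> s" using w(1) by (simp add: s_def field_simps)
    let ?T = "blaschke_product (\<lambda>k. a (k + N))"
    have EN: "Re (hardy_inner (F N) (F N)) \<le> E"
    proof -
      have "0 \<le> (\<Sum>n<N. (cmod (F n (a n)))\<^sup>2 * (1 - (cmod (a n))\<^sup>2))"
        using blaschke_sequence_norm[OF a] by (intro sum_nonneg mult_nonneg_nonneg) (auto simp: power_le_one less_imp_le)
      then show ?thesis using malmquist_norm[of a F N, OF step] by (simp add: E_def)
    qed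
    have T1: "1 - (cmod (?T w))\<^sup>2 \<le> 2 * \<epsilon> N"
    proof -
      have T_le: "cmod (?T w) \<le> 1" using bs w(2) by (rule blaschke_product_le_1)
      have "1 - (cmod (?T w))\<^sup>2 = (1 - cmod (?T w)) * (1 + cmod (?T w))"
        by (simp add: algebra_simps power2_eq_square)
      also have "\<dots> \<le> (1 - cmod (?T w)) * 2" using T_le by (intro mult_left_mono) auto
      also have "1 - cmod (?T w) \<le> cmod (?T w - 1)"
        using norm_triangle_ineq2[of 1 "?T w"] by (simp add: norm_minus_commute)
      also have "\<dots> \<le> exp (2 / (1 - cmod w) * \<tau> N) - 1"
        using blaschke_product_minus_1[OF bs w(2)] by (simp add: \<tau>_def)
      also have "\<dots> \<le> \<epsilon> N"
        unfolding \<epsilon>_def using ws s \<tau>0[of N] by (auto intro!: mult_right_mono divide_left_mono mult_pos_pos)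
      finally show ?thesis by simp
    qed
    have "(cmod (F N w))\<^sup>2 \<le> Re (hardy_inner (F N) (F N)) * ((1 - (cmod (?T w))\<^sup>2) / (1 - (cmod w)\<^sup>2))"
      by (rule orthogonal_to_multiples_bound[OF blaschke_product_holomorphic[OF bs] _ F _ w(2)])
         (use quotient_orthogonal_to_tail[OF a F0 F step] blaschke_product_le_1[OF bs] in auto)
    also have "\<dots> \<le> E * (2 * \<epsilon> N / (1 - s\<^sup>2))"
    proof (intro mult_mono frac_le EN T1 s2)
      show "0 \<le> E" unfolding E_def by (rule hardy_inner_self_nonneg[OF F])
      show "1 - s\<^sup>2 \<le> 1 - (cmod w)\<^sup>2" using ws by (simp add: power_mono)
      show "0 \<le> 2 * \<epsilon> N" using \<tau>0[of N] s by (simp add: \<epsilon>_def)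
      show "0 \<le> (1 - (cmod (?T w))\<^sup>2) / (1 - (cmod w)\<^sup>2)"
        using blaschke_product_le_1[OF bs w(2)] w(2) by (simp add: power_le_one)
    qed
    finally have "cmod (F N w) \<le> sqrt (E * (2 * \<epsilon> N / (1 - s\<^sup>2)))" by (rule real_le_rsqrt)
    moreover have "cmod (partial_blaschke a N w * F N w) \<le> cmod (F N w)"
      using partial_blaschke_le_1[OF a w(2), of N] by (simp add: norm_mult mult_left_le_one_le)
    ultimately show "cmod (partial_blaschke a N w * F N w) \<le> sqrt (E * (2 * \<epsilon> N / (1 - s\<^sup>2)))"
      by linarith
  qed
  then show ?thesis by (intro Lim_null_comparison[OF _ lim]) auto
qed

section \<open>Area integrals of products of singular kernels\<close>

lemma lborel_complex_eq: "(lborel :: complex measure) = distr (lborel \<Otimes>\<^sub>M lborel) borel (\<lambda>(x, y). Complex x y)"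
proof (rule lborel_eqI)
  have meas [measurable]: "(\<lambda>(x, y). Complex x y) \<in> borel_measurable (lborel \<Otimes>\<^sub>M lborel)"
    unfolding Complex_eq by measurable
  fix l u :: complex
  assume le: "\<And>b. b \<in> Basis \<Longrightarrow> l \<bullet> b \<le> u \<bullet> b"
  have le': "Re l \<le> Re u" "Im l \<le> Im u"
    using le[of 1] le[of \<i>] by (auto simp: Basis_complex_def)
  have "(\<lambda>(x, y). Complex x y) -` box l u = {Re l<..<Re u} \<times> {Im l<..<Im u}"
    by (auto simp: box_def Basis_complex_def)
  then have "emeasure (distr (lborel \<Otimes>\<^sub>M lborel) borel (\<lambda>(x, y). Complex x y)) (box l u)
      = emeasure (lborel \<Otimes>\<^sub>M lborel) ({Re l<..<Re u} \<times> {Im l<..<Im u})"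
    by (subst emeasure_distr) (auto simp: space_pair_measure)
  also have "\<dots> = ennreal (Re u - Re l) * ennreal (Im u - Im l)"
    using le' by (subst lborel.emeasure_pair_measure_Times) auto
  also have "\<dots> = (\<Prod>b\<in>Basis. (u - l) \<bullet> b)"
    using le' by (simp add: Basis_complex_def ennreal_mult)
  finally show "emeasure (distr (lborel \<Otimes>\<^sub>M lborel) borel (\<lambda>(x, y). Complex x y)) (box l u)
     = (\<Prod>b\<in>Basis. (u - l) \<bullet> b)" .
qed simp

lemma nn_integral_complex:
  assumes f [measurable]: "case_prod f \<in> borel_measurable (lborel \<Otimes>\<^sub>M lborel)"
  shows "(\<integral>\<^sup>+ z. f (Re z) (Im z) \<partial>lborel) = (\<integral>\<^sup>+ y. \<integral>\<^sup>+ x. f x y \<partial>lborel \<partial>lborel)"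
    "(\<integral>\<^sup>+ z. f (Re z) (Im z) \<partial>lborel) = (\<integral>\<^sup>+ x. \<integral>\<^sup>+ y. f x y \<partial>lborel \<partial>lborel)"
proof -
  have meas [measurable]: "(\<lambda>(x, y). Complex x y) \<in> borel_measurable (lborel \<Otimes>\<^sub>M lborel)"
    unfolding Complex_eq by measurable
  have f' [measurable]: "case_prod f \<in> borel_measurable borel"
    using f by (simp add: lborel_prod)
  have "(\<integral>\<^sup>+ z. f (Re z) (Im z) \<partial>lborel) = (\<integral>\<^sup>+ p. case_prod f p \<partial>(lborel \<Otimes>\<^sub>M lborel))"
  proof -
    have "(\<lambda>z::complex. case_prod f (Re z, Im z)) \<in> borel_measurable borel"
      by measurable
    then have "(\<lambda>z. f (Re z) (Im z)) \<in> borel_measurable borel" by simp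
    then show ?thesis
      by (subst lborel_complex_eq, subst nn_integral_distr[OF meas]) (auto intro!: nn_integral_cong)
  qed
  then show "(\<integral>\<^sup>+ z. f (Re z) (Im z) \<partial>lborel) = (\<integral>\<^sup>+ y. \<integral>\<^sup>+ x. f x y \<partial>lborel \<partial>lborel)"
    "(\<integral>\<^sup>+ z. f (Re z) (Im z) \<partial>lborel) = (\<integral>\<^sup>+ x. \<integral>\<^sup>+ y. f x y \<partial>lborel \<partial>lborel)"
    using lborel_pair.nn_integral_snd[OF f] lborel.nn_integral_fst[OF f] by simp_all
qed

text \<open>
  The value at 0 is infinite, unlike that of \<open>powr\<close>, so that upper bounds by this kernel hold at
  every point rather than almost everywhere.
\<close>

definition riesz_kernel :: "real \<Rightarrow> real \<Rightarrow> ennreal" where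
  "riesz_kernel q u = (if u = 0 then \<infinity> else ennreal (\<bar>u\<bar> powr - q))"

lemma riesz_kernel_measurable [measurable]: "riesz_kernel q \<in> borel_measurable borel"
  unfolding riesz_kernel_def by measurable

lemma powr_le_riesz_kernel:
  assumes "0 < q" "0 < v" "\<bar>u\<bar> \<le> v"
  shows "ennreal (v powr - q) \<le> riesz_kernel q u"
  using assms by (auto simp: riesz_kernel_def intro!: ennreal_leI powr_mono2')

definition riesz_mass :: "real \<Rightarrow> ennreal" where
  "riesz_mass q = (\<integral>\<^sup>+ u. indicator {-2..2} u * riesz_kernel q u \<partial>lborel)"

lemma riesz_mass_finite:
  assumes "q < 1"
  shows "riesz_mass q < \<infinity>"
proof -
  define f :: "real \<Rightarrow> real" where "f u = (if u \<in> {-2..2} then \<bar>u\<bar> powr - q else 0)" for u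
  obtain I where I: "((\<lambda>u. u powr - q) has_integral I) {0..2::real}"
    using has_integral_powr_from_0[of "-q" 2] assms by auto
  have 1: "((\<lambda>u. \<bar>u\<bar> powr - q) has_integral I) {0..2::real}"
    by (rule has_integral_eq[OF _ I]) auto
  then have 2: "((\<lambda>u. \<bar>u\<bar> powr - q) has_integral I) {-2..0::real}"
    using has_integral_reflect_real[of "\<lambda>u. \<bar>u\<bar> powr - q" I 2 0] by simp
  have "((\<lambda>u. \<bar>u\<bar> powr - q) has_integral (I + I)) {-2..2::real}"
    by (rule has_integral_combine[OF _ _ 2 1]) auto
  then have fI: "(f has_integral (I + I)) UNIV"
    unfolding f_def by (simp only: has_integral_restrict_UNIV)
  have fm: "f \<in> borel_measurable borel" unfolding f_def by measurable
  have "0 \<le> f u" for u by (simp add: f_def)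
  from nn_integral_has_integral_lborel[OF fm this fI]
  have "(\<integral>\<^sup>+ u. ennreal (f u) \<partial>lborel) = ennreal (I + I)" .
  moreover have "riesz_mass q = (\<integral>\<^sup>+ u. ennreal (f u) \<partial>lborel)"
    unfolding riesz_mass_def
  proof (rule nn_integral_cong_AE)
    show "AE u in lborel. indicator {-2..2} u * riesz_kernel q u = ennreal (f u)"
      using AE_lborel_singleton[of "0::real"]
      by eventually_elim (auto simp: f_def riesz_kernel_def indicator_def)
  qed
  ultimately show ?thesis by simp
qed

lemma riesz_kernel_translate:
  assumes "c \<in> {-1..1}"
  shows "(\<integral>\<^sup>+ u. indicator {-1..1} u * riesz_kernel q (u - c) \<partial>lborel) \<le> riesz_mass q"
proof -
  have "(\<integral>\<^sup>+ u. indicator {-1..1} u * riesz_kernel q (u - c) \<partial>lborel)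
     = (\<integral>\<^sup>+ u. indicator {-1..1} (c + u) * riesz_kernel q u \<partial>lborel)"
    using nn_integral_real_affine[of "\<lambda>u. indicator {-1..1} u * riesz_kernel q (u - c)" 1 c] by simp
  also have "\<dots> \<le> riesz_mass q"
    unfolding riesz_mass_def using assms by (intro nn_integral_mono) (auto simp: indicator_def)
  finally show ?thesis .
qed

text \<open>
  A majorant of the area kernel on the sector \<open>|y| \<le> |x|\<close>, in which the two singularities sit in
  different variables: for fixed \<open>y\<close> the circle is met at \<open>x = \<plusminus> sqrt (1 - y\<^sup>2)\<close>, and \<open>\<eta>\<close> is the
  height of the boundary point in whose direction the second kernel is large.
\<close>

definition sector_kernel :: "real \<Rightarrow> real \<Rightarrow> real \<Rightarrow> real \<Rightarrow> real \<Rightarrow> ennreal" where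
  "sector_kernel \<beta> q \<eta> x y =
     indicator {-1..1} y * riesz_kernel q (y - \<eta>) *
     (indicator {-1..1} x * riesz_kernel \<beta> (x - sqrt (1 - y\<^sup>2)) +
      indicator {-1..1} x * riesz_kernel \<beta> (x - (- sqrt (1 - y\<^sup>2))))"

lemma sector_kernel_measurable [measurable]:
  "(\<lambda>(x, y). sector_kernel \<beta> q \<eta> x y) \<in> borel_measurable (lborel \<Otimes>\<^sub>M lborel)"
  "(\<lambda>(x, y). sector_kernel \<beta> q \<eta> y x) \<in> borel_measurable (lborel \<Otimes>\<^sub>M lborel)"
  unfolding sector_kernel_def by measurable

lemma sector_kernel_integral:
  assumes "\<eta> \<in> {-1..1}"
  shows "(\<integral>\<^sup>+ y. \<integral>\<^sup>+ x. sector_kernel \<beta> q \<eta> x y \<partial>lborel \<partial>lborel) \<le> riesz_mass q * (riesz_mass \<beta> + riesz_mass \<beta>)"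
proof -
  have "(\<integral>\<^sup>+ x. sector_kernel \<beta> q \<eta> x y \<partial>lborel)
     \<le> indicator {-1..1} y * riesz_kernel q (y - \<eta>) * (riesz_mass \<beta> + riesz_mass \<beta>)" for y
  proof (cases "y \<in> {-1..1}")
    case True
    then have "y\<^sup>2 \<le> 1" by (simp add: abs_square_le_1 abs_le_iff)
    then have "sqrt (1 - y\<^sup>2) \<in> {-1..1}" "- sqrt (1 - y\<^sup>2) \<in> {-1..1}"
      by (auto intro: order_trans[of _ 0] simp: real_sqrt_ge_zero)
    note * = this[THEN riesz_kernel_translate, of \<beta>]
    have "(\<integral>\<^sup>+ x. sector_kernel \<beta> q \<eta> x y \<partial>lborel) = indicator {-1..1} y * riesz_kernel q (y - \<eta>) *
       ((\<integral>\<^sup>+ x. indicator {-1..1} x * riesz_kernel \<beta> (x - sqrt (1 - y\<^sup>2)) \<partial>lborel) +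
        (\<integral>\<^sup>+ x. indicator {-1..1} x * riesz_kernel \<beta> (x - (- sqrt (1 - y\<^sup>2))) \<partial>lborel))"
      unfolding sector_kernel_def by (subst nn_integral_cmult, measurable, subst nn_integral_add) auto
    also have "\<dots> \<le> indicator {-1..1} y * riesz_kernel q (y - \<eta>) * (riesz_mass \<beta> + riesz_mass \<beta>)"
      by (intro mult_left_mono add_mono *) auto
    finally show ?thesis .
  qed (simp add: sector_kernel_def)
  then have "(\<integral>\<^sup>+ y. \<integral>\<^sup>+ x. sector_kernel \<beta> q \<eta> x y \<partial>lborel \<partial>lborel)
     \<le> (\<integral>\<^sup>+ y. indicator {-1..1} y * riesz_kernel q (y - \<eta>) * (riesz_mass \<beta> + riesz_mass \<beta>) \<partial>lborel)"
    by (intro nn_integral_mono) auto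
  also have "\<dots> = (\<integral>\<^sup>+ y. indicator {-1..1} y * riesz_kernel q (y - \<eta>) \<partial>lborel) * (riesz_mass \<beta> + riesz_mass \<beta>)"
    by (intro nn_integral_multc) auto
  also have "\<dots> \<le> riesz_mass q * (riesz_mass \<beta> + riesz_mass \<beta>)"
    by (intro mult_right_mono riesz_kernel_translate assms) auto
  finally show ?thesis .
qed

text \<open>
  Within the sector the circle is nowhere close to horizontal, so that the distance to the circle
  is comparable to the horizontal distance.
\<close>

lemma sector_boundary_distance:
  fixes x y :: real
  assumes "x\<^sup>2 + y\<^sup>2 < 1" "\<bar>y\<bar> \<le> \<bar>x\<bar>"
  shows "\<bar>\<bar>x\<bar> - sqrt (1 - y\<^sup>2)\<bar> \<le> 4 * (1 - sqrt (x\<^sup>2 + y\<^sup>2))"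
proof -
  define X where "X = sqrt (1 - y\<^sup>2)"
  define s where "s = sqrt (x\<^sup>2 + y\<^sup>2)"
  have yx: "y\<^sup>2 \<le> x\<^sup>2" using assms(2) by (rule abs_le_square_iff[THEN iffD1])
  have "0 \<le> 1 - y\<^sup>2" using assms(1) zero_le_power2[of x] by linarith
  then have X2: "X\<^sup>2 = 1 - y\<^sup>2" by (simp add: X_def)
  have s2: "s\<^sup>2 = x\<^sup>2 + y\<^sup>2" by (simp add: s_def)
  have s: "0 \<le> s" "s \<le> 1" using assms(1) by (auto simp: s_def)
  \<comment> \<open>\<open>2 y\<^sup>2 \<le> x\<^sup>2 + y\<^sup>2 < 1\<close>, so even \<open>X\<^sup>2 \<ge> 1/2\<close>\<close>
  have "(1/2)\<^sup>2 \<le> X\<^sup>2" using X2 yx assms(1) by (simp add: power_divide)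
  then have X: "1/2 \<le> X" by (rule power2_le_imp_le) (use \<open>0 \<le> 1 - y\<^sup>2\<close> in \<open>simp add: X_def\<close>)
  have "\<bar>x\<bar>\<^sup>2 \<le> X\<^sup>2" using X2 assms(1) by simp
  then have xX: "\<bar>x\<bar> \<le> X" by (rule power2_le_imp_le) (use X in simp)
  have "(X - \<bar>x\<bar>) * (1/2) \<le> (X - \<bar>x\<bar>) * (X + \<bar>x\<bar>)" using X xX by (intro mult_left_mono) auto
  also have "\<dots> = X\<^sup>2 - x\<^sup>2" by (simp add: algebra_simps power2_eq_square)
  also have "\<dots> = (1 - s) * (1 + s)" using X2 s2 by (simp add: algebra_simps power2_eq_square)
  also have "\<dots> \<le> (1 - s) * 2" using s by (intro mult_left_mono) auto
  finally show ?thesis using xX by (simp add: X_def s_def)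
qed

lemma sector_kernel_bound:
  assumes "0 < \<beta>" "0 < q" "x\<^sup>2 + y\<^sup>2 < 1" "\<bar>y\<bar> \<le> \<bar>x\<bar>" "0 < v" "\<bar>y - \<eta>\<bar> \<le> v"
  shows "ennreal ((4 * (1 - sqrt (x\<^sup>2 + y\<^sup>2))) powr - \<beta> * v powr - q) \<le> sector_kernel \<beta> q \<eta> x y"
proof -
  have "x\<^sup>2 \<le> 1" "y\<^sup>2 \<le> 1"
    using assms(3) zero_le_power2[of x] zero_le_power2[of y] by linarith+
  then have x1: "x \<in> {-1..1}" "y \<in> {-1..1}"
    by (auto simp: abs_square_le_1 abs_le_iff)
  have pos: "0 < 4 * (1 - sqrt (x\<^sup>2 + y\<^sup>2))" using assms(3) by simp
  note dist = sector_boundary_distance[OF assms(3,4)]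
  have "ennreal ((4 * (1 - sqrt (x\<^sup>2 + y\<^sup>2))) powr - \<beta>)
      \<le> riesz_kernel \<beta> (x - sqrt (1 - y\<^sup>2)) + riesz_kernel \<beta> (x - (- sqrt (1 - y\<^sup>2)))"
  proof (cases "x \<ge> 0")
    case True
    then show ?thesis using dist
      by (intro add_increasing2 powr_le_riesz_kernel[OF assms(1) pos]) auto
  next
    case False
    then show ?thesis using dist
      by (intro add_increasing powr_le_riesz_kernel[OF assms(1) pos]) auto
  qed
  moreover have "ennreal (v powr - q) \<le> riesz_kernel q (y - \<eta>)"
    using assms by (intro powr_le_riesz_kernel) auto
  ultimately show ?thesis
    using x1 unfolding sector_kernel_def by (subst ennreal_mult) (auto simp: mult.commute intro!: mult_mono)
qed

text \<open>
  Replacing \<open>a\<close> by the boundary point \<open>w\<close> in its direction moves \<open>1 - cnj a z\<close> by at most \<open>1 - |a|\<close>,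
  which is itself at most \<open>|1 - cnj a z|\<close>; and \<open>|1 - cnj w z| = |w - z|\<close> because \<open>|w| = 1\<close>.
\<close>

lemma dist_to_direction_le:
  fixes a z :: complex
  assumes a: "0 < cmod a" "cmod a < 1" and z: "cmod z < 1"
  shows "cmod (a / of_real (cmod a) - z) \<le> 4 * cmod (1 - cnj a * z)"
proof -
  define w where "w = a / of_real (cmod a)"
  define t where "t = cmod a"
  have w: "cmod w = 1" using a by (simp add: w_def norm_divide)
  have aw: "a = of_real t * w" using a by (simp add: w_def t_def)
  have t: "0 < t" "t < 1" using a by (auto simp: t_def)
  define D where "D = cmod (1 - cnj a * z)"
  have D1: "1 - t \<le> D"
  proof -
    have "cmod a * cmod z \<le> cmod a" using a z by (intro mult_left_le) auto
    then show ?thesis using norm_triangle_ineq2[of 1 "cnj a * z"] by (simp add: D_def norm_mult t_def)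
  qed
  have "w * cnj w = 1" using w complex_norm_square[of w] by simp
  then have "w - z = w * ((1 - cnj a * z) + (of_real t - 1) * (cnj w * z))"
    by (simp add: aw algebra_simps)
  then have "cmod (w - z) = cmod ((1 - cnj a * z) + (of_real t - 1) * (cnj w * z))"
    using w by (simp add: norm_mult)
  also have "\<dots> \<le> D + cmod ((of_real t - 1) * (cnj w * z))"
    unfolding D_def by (rule norm_triangle_ineq)
  also have "cmod ((of_real t - 1) * (cnj w * z)) = (1 - t) * cmod z"
  proof -
    have "cmod (of_real (t - 1)) = 1 - t" using t by (simp only: norm_of_real)
    then show ?thesis using w by (simp add: norm_mult)
  qed
  also have "\<dots> \<le> (1 - t) * 1" using t z by (intro mult_left_mono) auto
  finally show ?thesis using D1 t by (simp add: w_def D_def)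
qed

text \<open>
  The disc is the union of the sector \<open>|Im z| \<le> |Re z|\<close> and its mirror image in the diagonal. On
  each of them the integrand is dominated by a product of one-dimensional kernels with exponents
  below 1, and Fubini's theorem bounds the integral independently of \<open>a\<close>.
\<close>

lemma disc_kernel_integral_bounded:
  assumes "0 < \<beta>" "\<beta> < 1" "0 < q" "q < 1"
  obtains C :: real where "\<And>a. 0 < cmod a \<Longrightarrow> cmod a < 1 \<Longrightarrow>
    (\<integral>\<^sup>+ z\<in>unit_disc. ennreal ((1 - cmod z) powr - \<beta> * cmod (1 - cnj a * z) powr - q) \<partial>lborel) \<le> ennreal C"
proof -
  define K where "K = riesz_mass q * (riesz_mass \<beta> + riesz_mass \<beta>)"
  have "K < \<infinity>"
    using riesz_mass_finite[OF assms(2)] riesz_mass_finite[OF assms(4)] by (simp add: K_def ennreal_mult_less_top)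
  define M where "M = ennreal (4 powr (\<beta> + q)) * (K + K)"
  have "M < \<infinity>" using \<open>K < \<infinity>\<close> by (simp add: M_def ennreal_mult_less_top)
  have "(\<integral>\<^sup>+ z\<in>unit_disc. ennreal ((1 - cmod z) powr - \<beta> * cmod (1 - cnj a * z) powr - q) \<partial>lborel) \<le> M"
    if a: "0 < cmod a" "cmod a < 1" for a
  proof -
    define w where "w = a / of_real (cmod a)"
    have "cmod w = 1" using a by (simp add: w_def norm_divide)
    then have w: "Re w \<in> {-1..1}" "Im w \<in> {-1..1}"
      using abs_Re_le_cmod[of w] abs_Im_le_cmod[of w] by auto
    define S1 where "S1 z = sector_kernel \<beta> q (Im w) (Re z) (Im z)" for z
    define S2 where "S2 z = sector_kernel \<beta> q (Re w) (Im z) (Re z)" for z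
    have meas [measurable]: "S1 \<in> borel_measurable lborel" "S2 \<in> borel_measurable lborel"
      unfolding S1_def S2_def sector_kernel_def by measurable
    have "ennreal ((1 - cmod z) powr - \<beta> * cmod (1 - cnj a * z) powr - q) \<le> ennreal (4 powr (\<beta> + q)) * (S1 z + S2 z)"
      if z: "cmod z < 1" for z
    proof -
      define v where "v = 4 * cmod (1 - cnj a * z)"
      have "cmod (cnj a * z) < 1" using a z mult_strict_mono[of "cmod a" 1 "cmod z" 1] by (simp add: norm_mult)
      then have "cnj a * z \<noteq> 1" by auto
      then have v: "0 < v" by (simp add: v_def)
      have d: "cmod (w - z) \<le> v" unfolding v_def w_def using a z by (rule dist_to_direction_le)
      have d1: "\<bar>Im z - Im w\<bar> \<le> v" "\<bar>Re z - Re w\<bar> \<le> v"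
        using abs_Im_le_cmod[of "w - z"] abs_Re_le_cmod[of "w - z"] d by auto
      have z2: "(Re z)\<^sup>2 + (Im z)\<^sup>2 < 1" "(Im z)\<^sup>2 + (Re z)\<^sup>2 < 1"
        using z by (auto simp: cmod_def)
      have "(1 - cmod z) powr - \<beta> * cmod (1 - cnj a * z) powr - q
        = 4 powr (\<beta> + q) * ((4 * (1 - cmod z)) powr - \<beta> * v powr - q)"
        by (simp only: v_def powr_mult powr_add powr_minus) (simp add: field_simps)
      moreover have "ennreal ((4 * (1 - cmod z)) powr - \<beta> * v powr - q) \<le> S1 z + S2 z"
      proof (cases "\<bar>Im z\<bar> \<le> \<bar>Re z\<bar>")
        case True
        then show ?thesis
          using sector_kernel_bound[OF assms(1,3) z2(1) True v d1(1)]
          by (auto simp: S1_def cmod_def intro!: add_increasing2)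
      next
        case False
        then show ?thesis
          using sector_kernel_bound[OF assms(1,3) z2(2) _ v d1(2)]
          by (auto simp: S2_def cmod_def add.commute intro!: add_increasing)
      qed
      ultimately show ?thesis by (simp add: ennreal_mult mult_left_mono)
    qed
    then have "(\<integral>\<^sup>+ z\<in>unit_disc. ennreal ((1 - cmod z) powr - \<beta> * cmod (1 - cnj a * z) powr - q) \<partial>lborel)
        \<le> (\<integral>\<^sup>+ z. ennreal (4 powr (\<beta> + q)) * (S1 z + S2 z) \<partial>lborel)"
      by (intro nn_integral_mono) (auto simp: indicator_def)
    also have "\<dots> = ennreal (4 powr (\<beta> + q)) * ((\<integral>\<^sup>+ z. S1 z \<partial>lborel) + (\<integral>\<^sup>+ z. S2 z \<partial>lborel))"
      by (subst nn_integral_cmult, measurable, subst nn_integral_add) auto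
    also have "\<dots> \<le> M"
      unfolding M_def K_def
    proof (intro mult_left_mono add_mono)
      show "(\<integral>\<^sup>+ z. S1 z \<partial>lborel) \<le> riesz_mass q * (riesz_mass \<beta> + riesz_mass \<beta>)"
        unfolding S1_def using nn_integral_complex(1)[OF sector_kernel_measurable(1)] sector_kernel_integral[OF w(2)]
        by simp
      show "(\<integral>\<^sup>+ z. S2 z \<partial>lborel) \<le> riesz_mass q * (riesz_mass \<beta> + riesz_mass \<beta>)"
        unfolding S2_def using nn_integral_complex(2)[OF sector_kernel_measurable(2)] sector_kernel_integral[OF w(1)]
        by simp
    qed auto
    finally show ?thesis .
  qed
  moreover have "ennreal (enn2real M) = M" using \<open>M < \<infinity>\<close> by simp
  ultimately show ?thesis using that[of "enn2real M"] by (simp only:)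
qed

section \<open>Summability of the derivative\<close>

lemma powr_add_le:
  fixes x y p :: real
  assumes "0 \<le> x" "0 \<le> y" "0 < p" "p \<le> 1"
  shows "(x + y) powr p \<le> x powr p + y powr p"
proof (cases "x + y = 0")
  case False
  define s where "s = x + y"
  have s: "s > 0" using False assms by (simp add: s_def)
  have "x / s \<le> (x / s) powr p" "y / s \<le> (y / s) powr p"
    using powr_mono'[of p 1 "x / s"] powr_mono'[of p 1 "y / s"] assms s by (auto simp: s_def)
  then have "x / s + y / s \<le> x powr p / s powr p + y powr p / s powr p"
    using assms s by (simp add: powr_divide)
  moreover have "x / s + y / s = 1" using s by (simp add: s_def flip: add_divide_distrib)
  ultimately have "1 \<le> (x powr p + y powr p) / s powr p" by (simp add: add_divide_distrib)
  then show ?thesis using s by (simp add: s_def)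
qed (use assms in auto)

lemma powr_sum_le:
  fixes x :: "'a \<Rightarrow> real"
  assumes "\<And>n. 0 \<le> x n" "0 < p" "p \<le> 1"
  shows "(\<Sum>n\<in>A. x n) powr p \<le> (\<Sum>n\<in>A. x n powr p)"
proof (induction A rule: infinite_finite_induct)
  case (insert m A)
  have "(x m + (\<Sum>n\<in>A. x n)) powr p \<le> x m powr p + (\<Sum>n\<in>A. x n) powr p"
    using assms by (intro powr_add_le sum_nonneg) auto
  with insert show ?case by simp
qed (use assms in simp_all)

text \<open>
  Young's inequality with exponents \<open>2/p\<close> and \<open>2/(2 - p)\<close>; the latter is what turns the power
  \<open>p/2\<close> of \<open>1 - |a n|\<close> into the power \<open>p/(2 - p)\<close> of the hypothesis on the zeros.
\<close>

lemma young_powr: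
  fixes x d p :: real
  assumes "0 \<le> x" "0 < d" "0 < p" "p < 2"
  shows "x powr (p / 2) * d powr (p / 2) \<le> x + d powr (p / (2 - p))"
proof (cases "x = 0")
  case False
  have "x powr (p / 2) * (d powr (p / (2 - p))) powr (1 - p / 2) \<le> p / 2 * x + (1 - p / 2) * d powr (p / (2 - p))"
    using assms False by (intro Youngs_inequality_0) auto
  also have "(d powr (p / (2 - p))) powr (1 - p / 2) = d powr (p / 2)"
  proof -
    have eq: "1 - p / 2 = (2 - p) / 2" by (simp add: diff_divide_distrib)
    have "p / (2 - p) * (1 - p / 2) = p / 2" unfolding eq using assms by simp
    then show ?thesis by (simp only: powr_powr)
  qed
  also have "p / 2 * x + (1 - p / 2) * d powr (p / (2 - p)) \<le> 1 * x + 1 * d powr (p / (2 - p))"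
    using assms by (intro add_mono mult_right_mono) auto
  finally show ?thesis by simp
qed (use assms in auto)

text \<open>
  The summand is \<open>(c s)\<^sup>p\<close> with \<open>s\<^sup>2 = 1 - |a n|\<^sup>2\<close> comparable to \<open>1 - |a n|\<close>, and the numbers \<open>c\<^sup>2\<close>
  have a finite sum by the Pythagorean identity; Young's inequality separates the two.
\<close>

lemma malmquist_coefficients_summable:
  assumes a: "blaschke_sequence a" and F: "\<And>n. F n \<in> hardy_space2"
    and step: "\<And>n. blaschke_quotient (a n) (F n) (F (Suc n))"
    and p: "0 < p" "p < 2" and sum: "summable (\<lambda>n. (1 - cmod (a n)) powr (p / (2 - p)))"
  shows "summable (\<lambda>n. (cmod (F n (a n)) * (1 - (cmod (a n))\<^sup>2)) powr p)"
proof -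
  define x where "x n = (cmod (F n (a n)))\<^sup>2 * (1 - (cmod (a n))\<^sup>2)" for n
  have an: "0 < 1 - cmod (a n)" "0 < 1 - (cmod (a n))\<^sup>2" "1 - (cmod (a n))\<^sup>2 \<le> 2 * (1 - cmod (a n))" for n
  proof -
    have *: "0 < cmod (a n)" "cmod (a n) < 1" using blaschke_sequence_norm[OF a] by auto
    then show "0 < 1 - cmod (a n)" "0 < 1 - (cmod (a n))\<^sup>2" by (auto simp: abs_square_less_1)
    have "1 - (cmod (a n))\<^sup>2 = (1 + cmod (a n)) * (1 - cmod (a n))" by (simp add: algebra_simps power2_eq_square)
    also have "\<dots> \<le> 2 * (1 - cmod (a n))" using * by (intro mult_right_mono) auto
    finally show "1 - (cmod (a n))\<^sup>2 \<le> 2 * (1 - cmod (a n))" .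
  qed
  have x0: "0 \<le> x n" for n using an(2)[of n] by (simp add: x_def)
  have "(\<Sum>n<N. x n) \<le> Re (hardy_inner (F 0) (F 0))" for N
    using malmquist_norm[of a F N, OF step] hardy_inner_self_nonneg[OF F, of N] by (simp add: x_def)
  then have "summable x" using x0 by (intro summableI_nonneg_bounded) auto
  show ?thesis
  proof (rule summable_comparison_test')
    show "summable (\<lambda>n. 2 powr (p / 2) * (x n + (1 - cmod (a n)) powr (p / (2 - p))))"
      by (intro summable_mult summable_add \<open>summable x\<close> sum)
    fix n
    let ?s = "1 - (cmod (a n))\<^sup>2" and ?u = "cmod (F n (a n))"
    have "(?u * ?s) powr p = ((?u * ?s)\<^sup>2) powr (p / 2)"
      using an(2)[of n] by (simp add: powr_powr flip: powr_numeral)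
    also have "(?u * ?s)\<^sup>2 = x n * ?s" by (simp add: x_def power2_eq_square mult_ac)
    also have "(x n * ?s) powr (p / 2) \<le> (x n * (2 * (1 - cmod (a n)))) powr (p / 2)"
      using x0[of n] an[of n] p by (intro powr_mono2 mult_left_mono) auto
    also have "\<dots> = 2 powr (p / 2) * (x n powr (p / 2) * (1 - cmod (a n)) powr (p / 2))"
      by (simp only: powr_mult mult_ac)
    also have "\<dots> \<le> 2 powr (p / 2) * (x n + (1 - cmod (a n)) powr (p / (2 - p)))"
      using young_powr[OF x0 an(1) p] by (intro mult_left_mono) auto
    finally show "norm ((?u * ?s) powr p) \<le> 2 powr (p / 2) * (x n + (1 - cmod (a n)) powr (p / (2 - p)))"
      by simp
  qed
qed

text \<open>
  For \<open>p \<le> 1\<close> the power \<open>p\<close> is subadditive and can be taken inside the finite expansion of the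
  derivative; the contribution of the remainder is eventually below any \<open>e\<close>.
\<close>

lemma model_space_deriv_bound:
  assumes a: "blaschke_sequence a" and F0: "F 0 \<in> model_space (blaschke_product a)"
    and F: "\<And>n. F n \<in> hardy_space2" and step: "\<And>n. blaschke_quotient (a n) (F n) (F (Suc n))"
    and p: "0 < p" "p \<le> 1" and z: "cmod z < 1"
  shows "ennreal (cmod (deriv (F 0) z) powr p * (1 - cmod z) powr \<alpha>) \<le>
    (\<Sum>n. ennreal (4 powr p * (cmod (F n (a n)) * (1 - (cmod (a n))\<^sup>2)) powr p) *
       ennreal ((1 - cmod z) powr - (p - \<alpha>) * cmod (1 - cnj (a n) * z) powr - p))" (is "ennreal ?L \<le> suminf ?t")
proof (rule ennreal_le_epsilon)
  fix e :: real assume e: "0 < e"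
  define C where "C n = cmod (F n (a n)) * (1 - (cmod (a n))\<^sup>2)" for n
  have C: "0 \<le> C n" for n using blaschke_sequence_norm[OF a, of n] by (simp add: C_def power_le_one)
  define D where "D n = cmod (1 - cnj (a n) * z)" for n
  define R where "R N = cmod (deriv (\<lambda>w. partial_blaschke a N w * F N w) z)" for N
  define t where "t n = 4 powr p * C n powr p * ((1 - cmod z) powr - (p - \<alpha>) * D n powr - p)" for n
  have z': "z \<in> unit_disc" using z by simp
  have R0: "0 \<le> R N" for N by (simp add: R_def)
  have "R \<longlonglongrightarrow> 0"
    unfolding R_def[abs_def] using malmquist_remainder_deriv[OF a F0 F step z] by (rule tendsto_norm_zero)
  then have "(\<lambda>N. R N powr p * (1 - cmod z) powr \<alpha>) \<longlonglongrightarrow> 0 powr p * (1 - cmod z) powr \<alpha>"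
    using p by (intro tendsto_mult tendsto_const tendsto_powr') (auto simp: R0)
  then have "\<forall>\<^sub>F N in sequentially. R N powr p * (1 - cmod z) powr \<alpha> < e"
    using e by (intro order_tendstoD(2)) auto
  then obtain N where N: "R N powr p * (1 - cmod z) powr \<alpha> < e"
    by (auto simp: eventually_sequentially)
  have rem: "(\<lambda>w. partial_blaschke a N w * F N w) holomorphic_on unit_disc"
    using partial_blaschke_holomorphic[OF a] hardy_space2_holomorphic[OF F] by (rule holomorphic_on_mult)
  have "((\<lambda>w. (\<Sum>n<N. malmquist_term a F n w) + partial_blaschke a N w * F N w) has_field_derivative
      (\<Sum>n<N. deriv (malmquist_term a F n) z) + deriv (\<lambda>w. partial_blaschke a N w * F N w) z) (at z)"
    by (intro DERIV_add DERIV_sum holomorphic_derivI[OF rem open_ball z']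
        holomorphic_derivI[OF malmquist_term_deriv(1)[OF a z] open_ball z'])
  then have "(F 0 has_field_derivative
      (\<Sum>n<N. deriv (malmquist_term a F n) z) + deriv (\<lambda>w. partial_blaschke a N w * F N w) z) (at z)"
    by (rule has_field_derivative_transform_within_open[OF _ open_ball z'])
       (rule malmquist_expansion[where a = a and F = F and N = N, OF step, symmetric])
  then have "deriv (F 0) z = (\<Sum>n<N. deriv (malmquist_term a F n) z) + deriv (\<lambda>w. partial_blaschke a N w * F N w) z"
    by (rule DERIV_imp_deriv)
  then have "cmod (deriv (F 0) z) \<le> cmod (\<Sum>n<N. deriv (malmquist_term a F n) z) + R N"
    unfolding R_def by (simp add: norm_triangle_ineq)
  also have "cmod (\<Sum>n<N. deriv (malmquist_term a F n) z) \<le> (\<Sum>n<N. 4 * C n / ((1 - cmod z) * D n))"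
    unfolding C_def D_def by (intro sum_norm_le malmquist_term_deriv(2) a z)
  finally have "cmod (deriv (F 0) z) \<le> (\<Sum>n<N. 4 * C n / ((1 - cmod z) * D n)) + R N" by simp
  then have "cmod (deriv (F 0) z) powr p \<le> ((\<Sum>n<N. 4 * C n / ((1 - cmod z) * D n)) + R N) powr p"
    using p by (intro powr_mono2) auto
  also have "\<dots> \<le> (\<Sum>n<N. 4 * C n / ((1 - cmod z) * D n)) powr p + R N powr p"
    using C z p by (intro powr_add_le sum_nonneg) (auto simp: R_def D_def)
  also have "\<dots> \<le> (\<Sum>n<N. (4 * C n / ((1 - cmod z) * D n)) powr p) + R N powr p"
    using C z p by (intro add_right_mono powr_sum_le) (auto simp: D_def)
  finally have "?L \<le> ((\<Sum>n<N. (4 * C n / ((1 - cmod z) * D n)) powr p) + R N powr p) * (1 - cmod z) powr \<alpha>"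
    by (intro mult_right_mono) auto
  also have "\<dots> = (\<Sum>n<N. (4 * C n / ((1 - cmod z) * D n)) powr p * (1 - cmod z) powr \<alpha>) + R N powr p * (1 - cmod z) powr \<alpha>"
    by (simp add: distrib_right sum_distrib_right)
  also have "(\<Sum>n<N. (4 * C n / ((1 - cmod z) * D n)) powr p * (1 - cmod z) powr \<alpha>) = (\<Sum>n<N. t n)"
  proof (rule sum.cong[OF refl])
    fix n
    have "(1 - cmod z) powr - (p - \<alpha>) = (1 - cmod z) powr \<alpha> / (1 - cmod z) powr p"
      using z by (simp flip: powr_diff)
    then show "(4 * C n / ((1 - cmod z) * D n)) powr p * (1 - cmod z) powr \<alpha> = t n"
      using C[of n] z by (simp add: t_def powr_divide powr_mult powr_minus inverse_powr D_def divide_inverse mult_ac)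
  qed
  finally have "?L \<le> (\<Sum>n<N. t n) + e" using N by linarith
  then have "ennreal ?L \<le> ennreal ((\<Sum>n<N. t n) + e)" by (rule ennreal_leI)
  also have "\<dots> = (\<Sum>n<N. ennreal (t n)) + ennreal e"
    using e by (subst ennreal_plus) (auto simp: t_def sum_ennreal intro!: sum_nonneg)
  also have "(\<Sum>n<N. ennreal (t n)) \<le> (\<Sum>n. ennreal (t n))"
    by (intro sum_le_suminf) auto
  also have "(\<Sum>n. ennreal (t n)) = suminf ?t"
    by (simp add: t_def C_def D_def ennreal_mult)
  finally show "ennreal ?L \<le> suminf ?t + ennreal e" by (simp add: add_right_mono)
qed

theorem theorem6:
  fixes a :: "nat \<Rightarrow> complex" and B :: "complex \<Rightarrow> complex" and \<alpha> p :: real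
  assumes "blaschke_sequence a"
    and "B = blaschke_product a"
    and "-1 < \<alpha>" and "\<alpha> \<le> 0"
    and "2/3 + 2/3 * \<alpha> \<le> p" and "p < 1 + \<alpha>"
    and "summable (\<lambda>n. (1 - cmod (a n)) powr (p / (2 - p)))"
  shows "\<forall>f \<in> model_space B. deriv f \<in> bergman_space \<alpha> p"
proof
  fix f assume "f \<in> model_space B"
  then have f: "f \<in> model_space (blaschke_product a)" by (simp add: assms(2))
  then have fH: "f \<in> hardy_space2" by (simp add: model_space_def hardy_orthogonal_complement_def)
  have p: "0 < p" "p < 1" "0 < p - \<alpha>" "p - \<alpha> < 1" using assms by auto
  obtain F where F: "F 0 = f" "\<And>n. F n \<in> hardy_space2" "\<And>n. blaschke_quotient (a n) (F n) (F (Suc n))"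
    using blaschke_quotients_exist[OF assms(1) fH] by blast
  have F0: "F 0 \<in> model_space (blaschke_product a)" using F(1) f by simp
  define c where "c n = 4 powr p * (cmod (F n (a n)) * (1 - (cmod (a n))\<^sup>2)) powr p" for n
  have c0: "0 \<le> c n" for n by (simp add: c_def)
  have "summable c"
    unfolding c_def using p by (intro summable_mult malmquist_coefficients_summable assms F) auto
  define w where "w n z = ennreal ((1 - cmod z) powr - (p - \<alpha>) * cmod (1 - cnj (a n) * z) powr - p)" for n z
  have [measurable]: "unit_disc \<in> sets borel" by simp
  have w [measurable]: "w n \<in> borel_measurable borel" for n unfolding w_def by measurable
  obtain C where C: "\<And>b. 0 < cmod b \<Longrightarrow> cmod b < 1 \<Longrightarrow>
      (\<integral>\<^sup>+ z\<in>unit_disc. ennreal ((1 - cmod z) powr - (p - \<alpha>) * cmod (1 - cnj b * z) powr - p) \<partial>lborel) \<le> ennreal C"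
    using disc_kernel_integral_bounded[OF p(3,4,1,2)] by blast
  have "(\<integral>\<^sup>+ z\<in>unit_disc. ennreal (cmod (deriv f z) powr p * (1 - cmod z) powr \<alpha>) \<partial>lborel)
      \<le> (\<integral>\<^sup>+ z. (\<Sum>n. ennreal (c n) * (w n z * indicator unit_disc z)) \<partial>lborel)"
  proof (rule nn_integral_mono)
    fix z :: complex
    show "ennreal (cmod (deriv f z) powr p * (1 - cmod z) powr \<alpha>) * indicator unit_disc z
        \<le> (\<Sum>n. ennreal (c n) * (w n z * indicator unit_disc z))"
      using model_space_deriv_bound[OF assms(1) F0 F(2,3) p(1), of z \<alpha>] p(2)
      by (cases "cmod z < 1") (simp_all add: F(1) c_def w_def)
  qed
  also have "\<dots> = (\<Sum>n. \<integral>\<^sup>+ z. ennreal (c n) * (w n z * indicator unit_disc z) \<partial>lborel)"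
    by (intro nn_integral_suminf) measurable
  also have "\<dots> = (\<Sum>n. ennreal (c n) * (\<integral>\<^sup>+ z\<in>unit_disc. w n z \<partial>lborel))"
    by (intro suminf_cong nn_integral_cmult) measurable
  also have "\<dots> \<le> (\<Sum>n. ennreal (c n) * ennreal C)"
    using C blaschke_sequence_norm[OF assms(1)] unfolding w_def
    by (intro suminf_le mult_left_mono) auto
  also have "\<dots> = ennreal (suminf c) * ennreal C"
    using suminf_ennreal2[OF c0 \<open>summable c\<close>] by simp
  also have "\<dots> < \<infinity>" by (simp add: ennreal_mult_less_top)
  finally show "deriv f \<in> bergman_space \<alpha> p"
    using fH by (simp add: bergman_space_def holomorphic_deriv hardy_space2_holomorphic)
qed

end
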